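(* Let $n\ge1$ be an integer and $\zeta$ a transcendental real number. Then \[\widehat{\lambda}_{2n}(\zeta)\le\sqrt{\Big(n+\frac{1}{2n}\Big)^2-\frac1n}-n+\frac{1}{2n}.\] If moreover $\lambda_{2n}(\zeta)>\frac1n$, then $\widehat{\lambda}_{2n}(\zeta)\le\frac{1}{n+1}$.
   Context: $\lambda_N(\zeta)$ (resp. $\widehat{\lambda}_N(\zeta)$) is the supremum of $\lambda$ such that the system $1\le|x|\le X$, $\max_{1\le i\le N}|\zeta^ix-y_i|\le X^{-\lambda}$ has a solution $(x,y_1,\dots,y_N)\in\mathbb{Z}^{N+1}$ for arbitrarily large $X$ (resp. for all sufficiently large $X$). *)

theory Defs
  imports
    "HOL-Computational_Algebra.Polynomial"
    "HOL-Library.Extended_Real"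
begin

definition approx_solvable :: "nat \<Rightarrow> real \<Rightarrow> real \<Rightarrow> real \<Rightarrow> bool" where
  "approx_solvable N \<zeta> l X \<longleftrightarrow>
     (\<exists>(x::int) (y::nat \<Rightarrow> int). 1 \<le> \<bar>x\<bar> \<and> real_of_int \<bar>x\<bar> \<le> X \<and>
        (\<forall>i\<in>{1..N}. \<bar>\<zeta> ^ i * real_of_int x - real_of_int (y i)\<bar> \<le> X powr (- l)))"

text \<open>The suprema are taken in the extended reals, since the ordinary exponent is infinite
  for Liouville numbers.\<close>

definition lambda_exp :: "nat \<Rightarrow> real \<Rightarrow> ereal" where
  "lambda_exp N \<zeta> = Sup {ereal l | l. \<exists>\<^sub>F X in at_top. approx_solvable N \<zeta> l X}"

definition lambda_hat_exp :: "nat \<Rightarrow> real \<Rightarrow> ereal" where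
  "lambda_hat_exp N \<zeta> = Sup {ereal l | l. \<forall>\<^sub>F X in at_top. approx_solvable N \<zeta> l X}"

end

theory Submission
  imports Defs "Jordan_Normal_Form.Determinant" "Berlekamp_Zassenhaus.Factor_Bound"
begin

text \<open>
  Write \<open>N = 2n\<close>, let \<open>q\<^sub>k\<close> be the denominators of the best simultaneous approximations to
  \<open>\<zeta>, \<dots>, \<zeta>\<^sup>N\<close>, let \<open>x\<^sub>k\<close> be the corresponding integer points and \<open>D\<^sub>k\<close> their errors. A uniform
  exponent \<open>\<alpha>\<close> means \<open>D\<^sub>k \<le> q\<^sub>k\<^sub>+\<^sub>1 powr (-\<alpha>)\<close>.

  If the ordinary exponent exceeds \<open>1/n\<close>, infinitely many \<open>x\<^sub>k\<close> are annihilated, as linear recurrent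
  sequences, by an integer polynomial of degree at most \<open>n\<close>, by Dirichlet's theorem. Let \<open>p\<^sub>k\<close> be the
  minimal one. For \<open>\<alpha> > 1/(n+1)\<close> Dirichlet's theorem in degree \<open>n+1\<close> gives another annihilator of
  \<open>x\<^sub>k\<close> of height \<open>O(q\<^sub>k powr (1/(n+1)))\<close>. By a gcd argument \<open>p\<^sub>k\<close> divides it, so the height of
  \<open>p\<^sub>k\<close> is small enough for \<open>p\<^sub>k\<close> to annihilate \<open>x\<^sub>k\<^sub>-\<^sub>1\<close> too. Hence \<open>p\<^sub>k\<^sub>-\<^sub>1\<close> exists and divides \<open>p\<^sub>k\<close>, the
  degrees stabilise, and a single polynomial annihilates all late \<open>x\<^sub>k\<close> and therefore vanishes at \<open>\<zeta>\<close>.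

  If the ordinary exponent is at most \<open>1/n\<close>, the bound on the uniform exponent is the inequality of
  Schmidt and Summerer. It follows from a nonzero determinant whose rows are the points
  \<open>x\<^sub>t\<^sub>+\<^sub>1\<close> that leave the span of their predecessors: subtracting the multiple of \<open>x\<^sub>t\<close> with the same
  leading entry bounds such a row by \<open>2 q\<^sub>t\<^sub>+\<^sub>1 D\<^sub>t / q\<^sub>t\<close>.
\<close>

hide_const (open) up_ring.coeff up_ring.monom Module.smult

subsection \<open>Best approximations\<close>

text \<open>Rounding picks the best numerator for each power, and index 0 returns q itself, so the
  values at 0..N form a single integer point with N + 1 coordinates.\<close>

definition near_pow :: "real \<Rightarrow> nat \<Rightarrow> nat \<Rightarrow> int" where
  "near_pow \<zeta> q i = round (\<zeta> ^ i * real q)"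

definition pow_err :: "nat \<Rightarrow> real \<Rightarrow> nat \<Rightarrow> real" where
  "pow_err N \<zeta> q = Max ((\<lambda>i. \<bar>\<zeta> ^ i * real q - of_int (near_pow \<zeta> q i)\<bar>) ` {1..N})"

lemma near_pow_0 [simp]: "near_pow \<zeta> q 0 = int q"
  using round_of_int[of "int q"] by (simp add: near_pow_def del: round_of_int)

lemma pow_err_ge:
  assumes "i \<le> N" "1 \<le> N"
  shows "\<bar>\<zeta> ^ i * real q - of_int (near_pow \<zeta> q i)\<bar> \<le> pow_err N \<zeta> q"
proof -
  have ge: "\<bar>\<zeta> ^ j * real q - of_int (near_pow \<zeta> q j)\<bar> \<le> pow_err N \<zeta> q" if "j \<in> {1..N}" for j
    unfolding pow_err_def using that by (intro Max_ge) auto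
  have "0 \<le> pow_err N \<zeta> q"
    using ge[of 1] assms by force
  then show ?thesis
    using ge[of i] assms by (cases "i = 0") auto
qed

lemma pow_err_le_iff:
  assumes "1 \<le> N"
  shows "pow_err N \<zeta> q \<le> e \<longleftrightarrow>
    (\<forall>i\<in>{1..N}. \<bar>\<zeta> ^ i * real q - of_int (near_pow \<zeta> q i)\<bar> \<le> e)"
  unfolding pow_err_def using assms by (subst Max_le_iff) auto

text \<open>A sign change makes the denominator positive and rounding is the optimal choice of
  numerators, so from here on only the function \<open>pow_err\<close> matters.\<close>

lemma approx_solvable_iff:
  assumes "1 \<le> N"
  shows "approx_solvable N \<zeta> l X \<longleftrightarrow> (\<exists>q\<ge>1. real q \<le> X \<and> pow_err N \<zeta> q \<le> X powr (- l))"
proof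
  assume "approx_solvable N \<zeta> l X"
  then obtain x :: int and y :: "nat \<Rightarrow> int" where x: "1 \<le> \<bar>x\<bar>" "real_of_int \<bar>x\<bar> \<le> X"
    and y: "\<And>i. i \<in> {1..N} \<Longrightarrow> \<bar>\<zeta> ^ i * real_of_int x - real_of_int (y i)\<bar> \<le> X powr (- l)"
    unfolding approx_solvable_def by blast
  define q where "q = nat \<bar>x\<bar>"
  have q: "real q = real_of_int \<bar>x\<bar>" "1 \<le> q"
    using x by (auto simp: q_def)
  have "\<bar>\<zeta> ^ i * real q - of_int (near_pow \<zeta> q i)\<bar> \<le> X powr (- l)" if i: "i \<in> {1..N}" for i
  proof -
    have "\<bar>\<zeta> ^ i * real q - of_int (near_pow \<zeta> q i)\<bar> \<le> \<bar>\<zeta> ^ i * real q - of_int (sgn x * y i)\<bar>"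
      unfolding near_pow_def by (rule round_diff_minimal)
    also have "\<zeta> ^ i * real q - of_int (sgn x * y i) = of_int (sgn x) * (\<zeta> ^ i * x - y i)"
      unfolding q using x(1) by (auto simp: sgn_if abs_if algebra_simps)
    also have "\<bar>\<dots>\<bar> = \<bar>\<zeta> ^ i * x - y i\<bar>"
      using x(1) by (auto simp: sgn_if abs_mult)
    finally show ?thesis
      using y[OF i] by linarith
  qed
  then have "pow_err N \<zeta> q \<le> X powr (- l)"
    using pow_err_le_iff[OF assms] by blast
  with q x show "\<exists>q\<ge>1. real q \<le> X \<and> pow_err N \<zeta> q \<le> X powr (- l)"
    by auto
next
  assume "\<exists>q\<ge>1. real q \<le> X \<and> pow_err N \<zeta> q \<le> X powr (- l)"
  then obtain q where "1 \<le> q" "real q \<le> X" "pow_err N \<zeta> q \<le> X powr (- l)"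
    by blast
  with assms show "approx_solvable N \<zeta> l X"
    unfolding approx_solvable_def
    unfolding pow_err_le_iff[OF assms]
    by (intro exI[of _ "int q"] exI[of _ "near_pow \<zeta> q"]) simp
qed

lemma approx_solvable_mono:
  assumes "approx_solvable N \<zeta> l X" "l' \<le> l" "1 \<le> X"
  shows "approx_solvable N \<zeta> l' X"
proof -
  have "X powr (- l) \<le> X powr (- l')"
    using assms by (intro powr_mono) auto
  then show ?thesis
    using assms(1) unfolding approx_solvable_def by (meson order_trans)
qed

lemma pow_err_pos:
  assumes "\<not> algebraic \<zeta>" "1 \<le> N" "1 \<le> q"
  shows "0 < pow_err N \<zeta> q"
proof (rule ccontr)
  assume "\<not> 0 < pow_err N \<zeta> q"
  then have "\<zeta> * real q = of_int (near_pow \<zeta> q 1)"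
    using pow_err_ge[of 1 N \<zeta> q] assms by auto
  then have "\<zeta> = of_int (near_pow \<zeta> q 1) / of_nat q"
    using assms(3) by (simp add: field_simps)
  then have "\<zeta> \<in> \<rat>"
    by (metis Rats_divide Rats_of_int Rats_of_nat)
  then show False
    using rat_imp_algebraic assms(1) by blast
qed

text \<open>Together, \<open>err_less\<close> and \<open>best\<close> make \<open>q (Suc k)\<close>
  the least denominator whose error is strictly below that of \<open>q k\<close>.\<close>

locale best_approx =
  fixes N :: nat and \<zeta> :: real and q :: "nat \<Rightarrow> nat"
  assumes N: "1 \<le> N"
    and transcendental: "\<not> algebraic \<zeta>"
    and q_pos: "\<And>k. 1 \<le> q k"
    and q_less: "\<And>k. q k < q (Suc k)"
    and err_less: "\<And>k. pow_err N \<zeta> (q (Suc k)) < pow_err N \<zeta> (q k)"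
    and best: "\<And>k m. 1 \<le> m \<Longrightarrow> m < q (Suc k) \<Longrightarrow> pow_err N \<zeta> (q k) \<le> pow_err N \<zeta> m"

text \<open>The passage to the least denominator with a smaller error is iterated from 1. It never
  stops, because errors are positive and become arbitrarily small.\<close>

lemma best_approx_exists:
  assumes N: "1 \<le> N" and tr: "\<not> algebraic \<zeta>"
    and small: "\<And>e. 0 < e \<Longrightarrow> \<exists>m\<ge>1. pow_err N \<zeta> m < e"
  shows "\<exists>q. best_approx N \<zeta> q"
proof -
  let ?D = "pow_err N \<zeta>"
  define nxt where "nxt p = (LEAST m. 1 \<le> m \<and> ?D m < ?D p)" for p
  define q where "q = rec_nat 1 (\<lambda>_. nxt)"
  have q0: "q 0 = 1" and qS: "q (Suc k) = nxt (q k)" for k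
    by (simp_all add: q_def)
  have nxt: "1 \<le> nxt p" "?D (nxt p) < ?D p" if "1 \<le> p" for p
  proof -
    have "\<exists>m. 1 \<le> m \<and> ?D m < ?D p"
      using small[of "?D p"] pow_err_pos[OF tr N that] by blast
    from LeastI_ex[OF this] show "1 \<le> nxt p" "?D (nxt p) < ?D p"
      unfolding nxt_def by blast+
  qed
  have pos: "1 \<le> q k" for k
    by (induction k) (auto simp: q0 qS nxt simp del: One_nat_def)
  have less: "?D (q (Suc k)) < ?D (q k)" for k
    using nxt(2)[OF pos] by (simp add: qS)
  have best: "?D (q k) \<le> ?D m" if "1 \<le> m" "m < q (Suc k)" for k m
    using not_less_Least[of m "\<lambda>m. 1 \<le> m \<and> ?D m < ?D (q k)"] that
    unfolding qS nxt_def by (meson not_le)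
  \<comment> \<open>\<open>nxt\<close> searches all denominators, not only those above
    \<open>q k\<close>. If \<open>q (Suc k)\<close> were smaller than \<open>q k\<close>, it would
    already have beaten \<open>q j\<close>, against the minimality of \<open>q k\<close>.\<close>
  have "q k < q (Suc k)" for k
  proof (cases k)
    case 0
    have "q (Suc 0) \<noteq> q 0"
      using less[of 0] by auto
    then show ?thesis
      using pos[of "Suc 0"] q0 0 by auto
  next
    case (Suc j)
    show ?thesis
    proof (rule ccontr)
      assume "\<not> ?thesis"
      then have "q (Suc k) \<le> q k" "q (Suc k) \<noteq> q k"
        using less[of k] by auto
      then have "?D (q j) \<le> ?D (q (Suc k))"
        using best[of "q (Suc k)" j] pos[of "Suc k"] Suc by simp
      then show False
        using less[of k] less[of j] Suc by simp
    qed
  qed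
  then show ?thesis
    using N tr pos less best by (intro exI[of _ q]) (simp add: best_approx_def)
qed

context best_approx
begin

abbreviation "D k \<equiv> pow_err N \<zeta> (q k)"
abbreviation "x k \<equiv> near_pow \<zeta> (q k)"

lemma q_strict_mono: "strict_mono q"
  using q_less by (simp add: strict_mono_Suc_iff)

lemma q_mono: "j \<le> k \<Longrightarrow> q j \<le> q k"
  using q_strict_mono by (simp add: strict_mono_less_eq)

lemma le_q: "k \<le> q k"
  using q_strict_mono by (rule strict_mono_imp_increasing)

lemma q_at_top: "filterlim (\<lambda>k. real (q k)) at_top sequentially"
  using filterlim_compose[OF filterlim_real_sequentially filterlim_subseq[OF q_strict_mono]] .

lemma D_pos: "0 < D k"
  using pow_err_pos transcendental N q_pos by blast

lemma D_antimono: "j \<le> k \<Longrightarrow> D k \<le> D j"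
  by (rule lift_Suc_antimono_le[of D]) (rule less_imp_le[OF err_less])

lemma x_err: "i \<le> N \<Longrightarrow> \<bar>\<zeta> ^ i * real (q k) - of_int (x k i)\<bar> \<le> D k"
  using pow_err_ge[OF _ N] .

lemma index_of:
  assumes "real (q 0) \<le> X"
  obtains k where "real (q k) \<le> X" "X < real (q (Suc k))"
proof -
  define k where "k = (LEAST k. X < real (q (Suc k)))"
  have "\<exists>k. X < real (q (Suc k))"
  proof -
    obtain m where "X < real m"
      using reals_Archimedean2 by blast
    then have "X < real (q (Suc m))"
      using le_q[of "Suc m"] by linarith
    then show ?thesis ..
  qed
  then have 1: "X < real (q (Suc k))"
    unfolding k_def by (rule LeastI_ex)
  have "real (q k) \<le> X"
  proof (cases k)
    case (Suc j)
    then show ?thesis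
      using not_less_Least[of j "\<lambda>k. X < real (q (Suc k))"] by (simp add: k_def[symmetric])
  qed (use assms in auto)
  then show thesis
    using 1 that by blast
qed

text \<open>No denominator below \<open>q (Suc k)\<close> beats \<open>q k\<close>, so
  \<open>D k\<close> is the smallest error available for X in this range.\<close>

lemma approx_solvable_iff_D:
  assumes "real (q k) \<le> X" "X < real (q (Suc k))"
  shows "approx_solvable N \<zeta> l X \<longleftrightarrow> D k \<le> X powr (- l)"
proof
  assume "approx_solvable N \<zeta> l X"
  then obtain m where m: "1 \<le> m" "real m \<le> X" "pow_err N \<zeta> m \<le> X powr (- l)"
    using approx_solvable_iff[OF N] by blast
  have "D k \<le> pow_err N \<zeta> m"
    using m assms by (intro best) auto
  then show "D k \<le> X powr (- l)"
    using m by linarith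
next
  assume "D k \<le> X powr (- l)"
  then show "approx_solvable N \<zeta> l X"
    using approx_solvable_iff[OF N] assms q_pos by blast
qed

text \<open>Solvability at X just below \<open>q (Suc k)\<close> bounds \<open>D k\<close> by a
  power of X. Letting X tend to \<open>q (Suc k)\<close> from the left gives the bound at the
  endpoint, where \<open>q (Suc k)\<close> itself takes over as best denominator.\<close>

lemma eventually_D_le:
  assumes "\<forall>\<^sub>F X in at_top. approx_solvable N \<zeta> l X"
  shows "\<forall>\<^sub>F k in sequentially. D k \<le> real (q (Suc k)) powr (- l)"
proof -
  obtain X0 where X0: "\<And>X. X \<ge> X0 \<Longrightarrow> approx_solvable N \<zeta> l X"
    using assms unfolding eventually_at_top_linorder by blast
  have "\<forall>\<^sub>F k in sequentially. X0 \<le> real (q k)"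
    using q_at_top by (simp add: filterlim_at_top)
  then show ?thesis
  proof eventually_elim
    case (elim k)
    let ?b = "real (q (Suc k))"
    have "\<forall>\<^sub>F X in at_left ?b. D k \<le> X powr (- l)"
      unfolding eventually_at_left_field
    proof (intro exI[of _ "real (q k)"] conjI allI impI)
      show "real (q k) < ?b"
        using q_less by simp
    next
      fix X assume "real (q k) < X" "X < ?b"
      then show "D k \<le> X powr (- l)"
        using approx_solvable_iff_D[of k X l] X0[of X] elim by auto
    qed
    moreover have "((\<lambda>X. X powr (- l)) \<longlongrightarrow> ?b powr (- l)) (at_left ?b)"
      using q_pos[of "Suc k"] by (intro tendsto_intros) auto
    ultimately show ?case
      by (intro tendsto_lowerbound) auto
  qed
qed

lemma eventually_less_D:
  assumes "\<forall>\<^sub>F X in at_top. \<not> approx_solvable N \<zeta> l X"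
  shows "\<forall>\<^sub>F k in sequentially. real (q k) powr (- l) < D k"
proof -
  have "\<forall>\<^sub>F k in sequentially. \<not> approx_solvable N \<zeta> l (real (q k))"
    using assms q_at_top by (rule eventually_compose_filterlim)
  then show ?thesis
  proof eventually_elim
    case (elim k)
    then show ?case
      using approx_solvable_iff_D[of k "real (q k)" l] q_less[of k] by auto
  qed
qed

lemma frequently_D_le:
  assumes "\<exists>\<^sub>F X in at_top. approx_solvable N \<zeta> l X"
  shows "\<exists>\<^sub>F k in sequentially. \<exists>X. real (q k) \<le> X \<and> D k \<le> X powr (- l)"
  unfolding frequently_sequentially
proof
  fix m
  have "\<exists>X>real (q m). approx_solvable N \<zeta> l X"
    using assms unfolding frequently_def eventually_at_top_dense by auto
  then obtain X where X: "real (q m) < X" "approx_solvable N \<zeta> l X"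
    by blast
  have "real (q 0) \<le> X"
    using X(1) q_mono[of 0 m] by auto
  then obtain k where k: "real (q k) \<le> X" "X < real (q (Suc k))"
    by (rule index_of)
  have "q m < q (Suc k)"
    using X k by linarith
  then have "m \<le> k"
    using q_strict_mono by (simp add: strict_mono_less)
  then show "\<exists>k\<ge>m. \<exists>X. real (q k) \<le> X \<and> D k \<le> X powr (- l)"
    using k X approx_solvable_iff_D by blast
qed

end

subsection \<open>Determinants of spanning chains\<close>

text \<open>Zero rows pad the given rows to a square matrix. Its row m vanishes, hence so does its
  determinant, and a singular integer matrix has a nonzero integer kernel vector.\<close>

lemma int_kernel_of_few_rows:
  fixes v :: "nat \<Rightarrow> nat \<Rightarrow> int"
  assumes "m < M"
  shows "\<exists>a. (\<exists>j<M. a j \<noteq> 0) \<and> (\<forall>i<m. (\<Sum>j<M. v i j * a j) = 0)"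
proof -
  define A where "A = mat M M (\<lambda>(i, j). if i < m then v i j else 0)"
  have A: "A \<in> carrier_mat M M"
    by (simp add: A_def)
  have "det A = 0"
    using assms
    by (subst det_def'[OF A], intro sum.neutral ballI) (auto simp: A_def permutes_in_image intro!: bexI[of _ m])
  then obtain w where w: "w \<in> carrier_vec M" "w \<noteq> 0\<^sub>v M" "A *\<^sub>v w = 0\<^sub>v M"
    using det_0_iff_vec_prod_zero[OF A] by blast
  have "\<exists>j<M. w $ j \<noteq> 0"
    using w(1,2) by (auto simp: vec_eq_iff)
  moreover have "(\<Sum>j<M. v i j * w $ j) = 0" if "i < m" for i
  proof -
    have "(A *\<^sub>v w) $ i = (\<Sum>j<M. v i j * w $ j)"
      using that assms w(1) by (simp add: A_def scalar_prod_def lessThan_atLeast0)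
    then show ?thesis
      using w(3) that assms by simp
  qed
  ultimately show ?thesis
    by (intro exI[of _ "\<lambda>j. w $ j"]) auto
qed

definition lin_span :: "nat \<Rightarrow> (nat \<Rightarrow> nat \<Rightarrow> int) \<Rightarrow> nat \<Rightarrow> (nat \<Rightarrow> int) \<Rightarrow> bool" where
  "lin_span M v m y \<longleftrightarrow> (\<exists>c :: nat \<Rightarrow> real. \<forall>j<M. of_int (y j) = (\<Sum>l\<le>m. c l * of_int (v l j)))"

lemma lin_span_cong:
  assumes "\<And>l. l \<le> m \<Longrightarrow> v l = v' l"
  shows "lin_span M v m y \<longleftrightarrow> lin_span M v' m y"
  unfolding lin_span_def using assms by auto

lemma lin_span_base:
  assumes "l \<le> m"
  shows "lin_span M v m (v l)"
  unfolding lin_span_def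
  by (rule exI[of _ "\<lambda>k. if k = l then 1 else 0"])
     (use assms in \<open>simp add: if_distrib[of "\<lambda>x. x * _"] sum.delta cong: if_cong\<close>)

lemma lin_span_Suc:
  assumes "lin_span M v m y"
  shows "lin_span M v (Suc m) y"
proof -
  obtain c :: "nat \<Rightarrow> real" where c: "\<And>j. j < M \<Longrightarrow> of_int (y j) = (\<Sum>l\<le>m. c l * of_int (v l j))"
    using assms unfolding lin_span_def by blast
  show ?thesis
    unfolding lin_span_def
  proof (intro exI[of _ "c(Suc m := 0)"] allI impI)
    fix j assume "j < M"
    have "(\<Sum>l\<le>m. (c(Suc m := 0)) l * of_int (v l j)) = (\<Sum>l\<le>m. c l * of_int (v l j))"
      by (intro sum.cong) auto
    then show "of_int (y j) = (\<Sum>l\<le>Suc m. (c(Suc m := 0)) l * of_int (v l j))"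
      using c[OF \<open>j < M\<close>] by simp
  qed
qed

lemma lin_span_functional:
  fixes a :: "nat \<Rightarrow> int"
  assumes "lin_span M v m y" "\<And>l. l \<le> m \<Longrightarrow> (\<Sum>j<M. v l j * a j) = 0"
  shows "(\<Sum>j<M. y j * a j) = 0"
proof -
  obtain c :: "nat \<Rightarrow> real" where c: "\<And>j. j < M \<Longrightarrow> of_int (y j) = (\<Sum>l\<le>m. c l * of_int (v l j))"
    using assms unfolding lin_span_def by blast
  have "of_int (\<Sum>j<M. y j * a j) = (\<Sum>j<M. \<Sum>l\<le>m. c l * (of_int (v l j) * of_int (a j)))"
    by (simp add: c sum_distrib_right mult.assoc)
  also have "\<dots> = (\<Sum>l\<le>m. c l * (\<Sum>j<M. of_int (v l j) * of_int (a j)))"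
    by (subst sum.swap) (simp add: sum_distrib_left)
  also have "\<dots> = (\<Sum>l\<le>m. c l * of_int (\<Sum>j<M. v l j * a j))"
    by simp
  also have "\<dots> = (0 :: real)"
    by (intro sum.neutral) (simp add: assms(2) del: of_int_sum)
  finally show ?thesis
    by (simp only: of_int_eq_0_iff)
qed

text \<open>These become the rows of the determinant. The shift by one is there because, in
  \<open>spanning_chain\<close>, \<open>t i\<close> is the last index before the span grows.\<close>

definition chain_row :: "(nat \<Rightarrow> nat \<Rightarrow> int) \<Rightarrow> nat \<Rightarrow> (nat \<Rightarrow> nat) \<Rightarrow> nat \<Rightarrow> nat \<Rightarrow> int" where
  "chain_row x k t i = (case i of 0 \<Rightarrow> x k | Suc i' \<Rightarrow> x (Suc (t i')))"

lemma chain_row_0 [simp]: "chain_row x k t 0 = x k"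
  and chain_row_Suc [simp]: "chain_row x k t (Suc i) = x (Suc (t i))"
  by (simp_all add: chain_row_def)

text \<open>Fewer than M rows are killed by a nonzero integer functional, which by
  \<open>nodep\<close> cannot kill all later points, so some point leaves their span. The index just
  before the first such point is recorded; its own point still lies in the span.\<close>

lemma spanning_chain:
  fixes x :: "nat \<Rightarrow> nat \<Rightarrow> int"
  assumes nodep: "\<And>a. (\<And>s. s \<ge> k \<Longrightarrow> (\<Sum>j<M. x s j * a j) = 0) \<Longrightarrow> (\<forall>j<M. a j = 0)"
    and "m < M"
  shows "\<exists>t. (\<forall>i<m. k \<le> t i \<and> \<not> lin_span M (chain_row x k t) i (x (Suc (t i))) \<and>
              (\<forall>s\<in>{k..t i}. lin_span M (chain_row x k t) i (x s))) \<and>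
             (\<forall>i<m. \<forall>j<i. t j < t i)"
  using \<open>m < M\<close>
proof (induction m)
  case 0
  show ?case by simp
next
  case (Suc m)
  from Suc.IH[OF Suc_lessD[OF Suc.prems]] obtain t where
    T: "\<forall>i<m. k \<le> t i \<and> \<not> lin_span M (chain_row x k t) i (x (Suc (t i))) \<and>
              (\<forall>s\<in>{k..t i}. lin_span M (chain_row x k t) i (x s))"
      "\<forall>i<m. \<forall>j<i. t j < t i"
    by (elim exE conjE)
  have t: "\<And>i. i < m \<Longrightarrow> k \<le> t i"
    "\<And>i. i < m \<Longrightarrow> \<not> lin_span M (chain_row x k t) i (x (Suc (t i)))"
    "\<And>i s. i < m \<Longrightarrow> s \<in> {k..t i} \<Longrightarrow> lin_span M (chain_row x k t) i (x s)"
    "\<And>i j. i < m \<Longrightarrow> j < i \<Longrightarrow> t j < t i"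
    using T by simp_all
  let ?v = "chain_row x k t"
  obtain a where a: "\<exists>j<M. a j \<noteq> 0" "\<And>i. i < Suc m \<Longrightarrow> (\<Sum>j<M. ?v i j * a j) = 0"
    using int_kernel_of_few_rows[OF Suc.prems, of ?v] by blast
  define s where "s = (LEAST s. k \<le> s \<and> \<not> lin_span M ?v m (x s))"
  have "\<exists>s\<ge>k. \<not> lin_span M ?v m (x s)"
  proof (rule ccontr)
    assume "\<not> ?thesis"
    then have "(\<Sum>j<M. x s j * a j) = 0" if "s \<ge> k" for s
      using lin_span_functional[of M ?v m "x s" a] a(2) that by auto
    then show False
      using nodep a(1) by blast
  qed
  then have "\<exists>s. k \<le> s \<and> \<not> lin_span M ?v m (x s)"
    by blast
  from LeastI_ex[OF this] have s: "k \<le> s" "\<not> lin_span M ?v m (x s)"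
    unfolding s_def by blast+
  have below: "lin_span M ?v m (x r)" if "k \<le> r" "r < s" for r
    using not_less_Least[of r] that unfolding s_def by blast
  have "s \<noteq> k"
    using s(2) lin_span_base[of 0 m M ?v] by auto
  define u where "u = s - 1"
  have u: "s = Suc u" "k \<le> u"
    using s(1) \<open>s \<noteq> k\<close> by (auto simp: u_def)
  \<comment> \<open>All points from k up to \<open>Suc (t m')\<close> lie in the span of rows 0 to
    m, the last of which is \<open>x (Suc (t m'))\<close>; hence the first point outside comes
    later.\<close>
  have inc: "t j < u" if jm: "j < m" for j
  proof -
    obtain m' where m': "m = Suc m'"
      using jm by (cases m) auto
    have "lin_span M ?v m (x r)" if r: "r \<in> {k..Suc (t m')}" for r
    proof (cases "r = Suc (t m')")
      case True
      then show ?thesis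
        using lin_span_base[of m m M ?v] by (simp add: m')
    next
      case False
      then show ?thesis
        using lin_span_Suc[OF t(3)[of m' r]] r by (simp add: m')
    qed
    then have "Suc (t m') < s"
      using s not_less by auto
    moreover have "t j \<le> t m'"
      using t(4)[of m' j] jm by (cases "j = m'") (auto simp: m')
    ultimately show ?thesis
      using u by simp
  qed
  define t' where "t' = t(m := u)"
  \<comment> \<open>Row m reads at most \<open>t (m - 1)\<close>, so resetting \<open>t m\<close>
    leaves rows 0 to m unchanged.\<close>
  have cong: "lin_span M (chain_row x k t') i y \<longleftrightarrow> lin_span M ?v i y" if "i \<le> m" for i y
  proof (rule lin_span_cong)
    fix l assume "l \<le> i"
    then show "chain_row x k t' l = chain_row x k t l"
      using that by (cases l) (auto simp: t'_def)
  qed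
  have t'm: "t' m = u" and t'i: "i < m \<Longrightarrow> t' i = t i" for i
    by (auto simp: t'_def)
  show ?case
  proof (rule exI[of _ t'], intro conjI allI impI ballI)
    fix i assume "i < Suc m"
    then show "k \<le> t' i"
      using t(1) u by (cases "i = m") (auto simp: t'm t'i)
    show "\<not> lin_span M (chain_row x k t') i (x (Suc (t' i)))"
      using \<open>i < Suc m\<close> t(2)[of i] s(2) u by (cases "i = m") (auto simp: cong t'm t'i)
    show "lin_span M (chain_row x k t') i (x r)" if "r \<in> {k..t' i}" for r
      using that \<open>i < Suc m\<close> t(3)[of i r] below[of r] u by (cases "i = m") (auto simp: cong t'm t'i)
    show "t' j < t' i" if "j < i" for j
      using that \<open>i < Suc m\<close> t(4)[of i j] inc[of j] by (cases "i = m") (auto simp: t'm t'i)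
  qed
qed

text \<open>A singular matrix has a nontrivial relation among its rows. Solved for the last row with
  nonzero coefficient, it puts that row into the span of its predecessors, or makes row 0
  vanish.\<close>

lemma det_nonzero_if_independent:
  fixes v :: "nat \<Rightarrow> nat \<Rightarrow> int"
  assumes "\<exists>j<M. v 0 j \<noteq> 0" "\<And>i. Suc i < M \<Longrightarrow> \<not> lin_span M v i (v (Suc i))"
  shows "det (mat M M (\<lambda>(i, j). v i j)) \<noteq> 0"
proof
  let ?A = "mat M M (\<lambda>(i, j). v i j)"
  assume "det ?A = 0"
  then have "det (transpose_mat ?A) = 0"
    by (subst det_transpose[of _ M]) auto
  then obtain w where w: "w \<in> carrier_vec M" "w \<noteq> 0\<^sub>v M" "transpose_mat ?A *\<^sub>v w = 0\<^sub>v M"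
    using det_0_iff_vec_prod_zero[of "transpose_mat ?A" M] by auto
  have sum0: "(\<Sum>i<M. w $ i * v i j) = 0" if "j < M" for j
  proof -
    have "(transpose_mat ?A *\<^sub>v w) $ j = (\<Sum>i<M. w $ i * v i j)"
      using that w(1) by (simp add: scalar_prod_def lessThan_atLeast0 mult.commute)
    then show ?thesis
      using w(3) that by simp
  qed
  define r where "r = Max {i. i < M \<and> w $ i \<noteq> 0}"
  have ne: "{i. i < M \<and> w $ i \<noteq> 0} \<noteq> {}"
    using w(1,2) by (auto simp: vec_eq_iff)
  then have r: "r < M" "w $ r \<noteq> 0"
    using Max_in[of "{i. i < M \<and> w $ i \<noteq> 0}"] unfolding r_def by auto
  have "w $ i = 0" if "i < M" "r < i" for i
  proof (rule ccontr)
    assume "w $ i \<noteq> 0"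
    then have "i \<le> r"
      unfolding r_def using that by (intro Max_ge) auto
    then show False
      using that by simp
  qed
  then have sum_r: "(\<Sum>i\<le>r. w $ i * v i j) = 0" if "j < M" for j
    using sum0[OF that] r(1) by (subst sum.mono_neutral_left[of "{..<M}"]) auto
  show False
  proof (cases r)
    case 0
    then show False
      using sum_r assms(1) r(2) by auto
  next
    case (Suc i)
    have "lin_span M v i (v (Suc i))"
      unfolding lin_span_def
    proof (intro exI[of _ "\<lambda>l. - of_int (w $ l) / of_int (w $ r)"] allI impI)
      fix j assume "j < M"
      have "(\<Sum>l\<le>i. w $ l * v l j) + w $ r * v r j = 0"
        using sum_r[OF \<open>j < M\<close>] by (simp add: Suc)
      then have "of_int ((\<Sum>l\<le>i. w $ l * v l j) + w $ r * v r j) = (0 :: real)"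
        by (simp only: of_int_0)
      then have "of_int (w $ r) * of_int (v r j) = - (\<Sum>l\<le>i. of_int (w $ l) * real_of_int (v l j))"
        by simp
      then have "real_of_int (v r j) = - (\<Sum>l\<le>i. of_int (w $ l) * real_of_int (v l j)) / of_int (w $ r)"
        using r(2) by (simp add: field_simps)
      also have "\<dots> = (\<Sum>l\<le>i. - of_int (w $ l) / of_int (w $ r) * of_int (v l j))"
        by (simp add: sum_negf sum_divide_distrib)
      finally show "of_int (v (Suc i) j) = (\<Sum>l\<le>i. - of_int (w $ l) / of_int (w $ r) * real_of_int (v l j))"
        by (simp add: Suc)
    qed
    then show False
      using assms(2)[of i] r(1) Suc by auto
  qed
qed

lemma abs_det_le:
  fixes w :: "nat \<Rightarrow> nat \<Rightarrow> real"
  assumes "\<And>i j. i < M \<Longrightarrow> j < M \<Longrightarrow> \<bar>w i j\<bar> \<le> b i"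
  shows "\<bar>det (mat M M (\<lambda>(i, j). w i j))\<bar> \<le> fact M * (\<Prod>i<M. b i)"
proof -
  let ?P = "{p. p permutes {0..<M}}"
  have "\<bar>det (mat M M (\<lambda>(i, j). w i j))\<bar>
      = \<bar>\<Sum>p\<in>?P. signof p * (\<Prod>i = 0..<M. w i (p i))\<bar>"
    by (subst det_def'[of _ M]) (auto intro!: arg_cong[of _ _ abs] sum.cong prod.cong simp: permutes_in_image)
  also have "\<dots> \<le> (\<Sum>p\<in>?P. \<bar>signof p * (\<Prod>i = 0..<M. w i (p i))\<bar>)"
    by (rule sum_abs)
  also have "\<dots> \<le> (\<Sum>p\<in>?P. \<Prod>i<M. b i)"
  proof (intro sum_mono)
    fix p assume "p \<in> ?P"
    then have p: "i < M \<Longrightarrow> p i < M" for i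
      using permutes_in_image[of p "{0..<M}" i] by auto
    have "\<bar>signof p * (\<Prod>i = 0..<M. w i (p i))\<bar> = (\<Prod>i<M. \<bar>w i (p i)\<bar>)"
      by (simp add: abs_mult abs_prod sign_def lessThan_atLeast0)
    also have "\<dots> \<le> (\<Prod>i<M. b i)"
      using assms p by (intro prod_mono) auto
    finally show "\<bar>signof p * (\<Prod>i = 0..<M. w i (p i))\<bar> \<le> (\<Prod>i<M. b i)" .
  qed
  also have "\<dots> = fact M * (\<Prod>i<M. b i)"
    by (simp add: card_permutations[of "{0..<M}" M])
  finally show ?thesis .
qed

text \<open>The new matrix is the old one multiplied from the left by a lower triangular matrix with
  unit diagonal.\<close>

lemma det_subtract_earlier_rows:
  fixes v w :: "nat \<Rightarrow> nat \<Rightarrow> real"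
  assumes "\<And>i j. i < M \<Longrightarrow> j < M \<Longrightarrow> w i j = v i j + (\<Sum>l<i. c i l * v l j)"
  shows "det (mat M M (\<lambda>(i, j). w i j)) = det (mat M M (\<lambda>(i, j). v i j))"
proof -
  define E where "E = mat M M (\<lambda>(i, l). if l < i then c i l else if l = i then 1 else 0)"
  have E: "E \<in> carrier_mat M M"
    by (simp add: E_def)
  have "mat M M (\<lambda>(i, j). w i j) = E * mat M M (\<lambda>(i, j). v i j)"
  proof (rule eq_matI)
    fix i j assume "i < dim_row (E * mat M M (\<lambda>(i, j). v i j))" "j < dim_col (E * mat M M (\<lambda>(i, j). v i j))"
    then have ij: "i < M" "j < M"
      by (simp_all add: E_def)
    have "(\<Sum>l = 0..<M. E $$ (i, l) * v l j) = (\<Sum>l\<in>{..<Suc i}. E $$ (i, l) * v l j)"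
      using ij by (intro sum.mono_neutral_right) (auto simp: E_def)
    also have "\<dots> = v i j + (\<Sum>l<i. c i l * v l j)"
      using ij by (simp add: E_def)
    finally show "mat M M (\<lambda>(i, j). w i j) $$ (i, j) = (E * mat M M (\<lambda>(i, j). v i j)) $$ (i, j)"
      using ij E assms[OF ij] by (simp add: scalar_prod_def)
  qed (simp_all add: E_def)
  moreover have "det E = 1"
    by (subst det_lower_triangular[OF _ E]) (auto simp: E_def prod_list_diag_prod)
  ultimately show ?thesis
    using det_mult[OF E, of "mat M M (\<lambda>(i, j). v i j)"] by simp
qed

section \<open>The determinant estimate and the Schmidt-Summerer inequality\<close>

context best_approx
begin

text \<open>Replacing \<open>x k j\<close> by \<open>\<zeta> ^ j * q k\<close> changes the vanishing
  sum by a bounded amount. So \<open>q k\<close> times the limit value stays bounded for arbitrarily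
  large \<open>q k\<close>.\<close>

lemma limit_functional:
  fixes a :: "nat \<Rightarrow> int"
  assumes "\<exists>\<^sub>F k in sequentially. (\<Sum>j\<le>N. of_int (x k j) * of_int (a j)) = (0 :: real)"
  shows "(\<Sum>j\<le>N. of_int (a j) * \<zeta> ^ j) = 0"
proof (rule ccontr)
  define s where "s = (\<Sum>j\<le>N. of_int (a j) * \<zeta> ^ j)"
  define b where "b = (\<Sum>j\<le>N. \<bar>of_int (a j)\<bar>) * D 0"
  assume "(\<Sum>j\<le>N. of_int (a j) * \<zeta> ^ j) \<noteq> 0"
  then have s: "0 < \<bar>s\<bar>"
    by (simp add: s_def)
  have "\<forall>\<^sub>F k in sequentially. b / \<bar>s\<bar> < real (q k)"
    using q_at_top by (auto simp: filterlim_at_top_dense)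
  from frequently_ex[OF frequently_eventually_frequently[OF assms this]]
  obtain k where k: "(\<Sum>j\<le>N. of_int (x k j) * of_int (a j)) = (0 :: real)" "b / \<bar>s\<bar> < real (q k)"
    by (elim exE conjE)
  have "real (q k) * s = (\<Sum>j\<le>N. of_int (a j) * (\<zeta> ^ j * real (q k) - of_int (x k j)))"
    using k(1) by (simp add: s_def sum_distrib_left sum_subtractf algebra_simps)
  also have "\<bar>\<dots>\<bar> \<le> (\<Sum>j\<le>N. \<bar>of_int (a j)\<bar> * D 0)"
  proof (intro order_trans[OF sum_abs] sum_mono)
    fix j assume "j \<in> {..N}"
    then have "\<bar>\<zeta> ^ j * real (q k) - of_int (x k j)\<bar> \<le> D 0"
      using x_err[of j k] D_antimono[of 0 k] by auto
    then show "\<bar>of_int (a j) * (\<zeta> ^ j * real (q k) - of_int (x k j))\<bar> \<le> \<bar>of_int (a j)\<bar> * D 0"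
      by (simp add: abs_mult mult_left_mono)
  qed
  finally have "real (q k) * \<bar>s\<bar> \<le> b"
    by (simp add: b_def sum_distrib_right abs_mult)
  then show False
    using k(2) s by (simp add: field_simps)
qed

lemma no_linear_relation:
  fixes a :: "nat \<Rightarrow> int"
  assumes "(\<Sum>j\<le>N. of_int (a j) * \<zeta> ^ j) = 0" "j \<le> N"
  shows "a j = 0"
proof (rule ccontr)
  assume "a j \<noteq> 0"
  define p where "p = (\<Sum>j\<le>N. monom (real_of_int (a j)) j)"
  have coeff: "coeff p i = (if i \<le> N then of_int (a i) else 0)" for i
    unfolding p_def by (simp add: coeff_sum if_distrib cong: if_cong)
  have "poly p \<zeta> = (\<Sum>j\<le>N. of_int (a j) * \<zeta> ^ j)"
    by (simp add: p_def poly_sum poly_monom)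
  moreover have "p \<noteq> 0"
    using coeff[of j] \<open>a j \<noteq> 0\<close> assms(2) by auto
  ultimately show False
    using transcendental algebraicI[of p \<zeta>] assms(1) by (auto simp: coeff)
qed

definition pow_max :: real where "pow_max = max 1 \<bar>\<zeta>\<bar> ^ N"

lemma pow_max_pos: "0 < pow_max"
  unfolding pow_max_def by (intro zero_less_power) auto

lemma abs_pow_le_pow_max:
  assumes "i \<le> N"
  shows "\<bar>\<zeta> ^ i\<bar> \<le> pow_max"
proof -
  have "\<bar>\<zeta> ^ i\<bar> \<le> max 1 \<bar>\<zeta>\<bar> ^ i"
    by (simp add: power_abs power_mono)
  also have "\<dots> \<le> pow_max"
    unfolding pow_max_def using assms by (intro power_increasing) auto
  finally show ?thesis .
qed

text \<open>A nonzero integer determinant has absolute value at least 1. The upper bound combines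
  the number of Leibniz terms, the entry bound \<open>(pow_max + 1) * q k\<close> of row 0, and
  twice one factor of the product for each later row.\<close>

lemma determinant_estimate:
  obtains t where "\<And>i. i < N \<Longrightarrow> k \<le> t i" "\<And>i j. i < N \<Longrightarrow> j < i \<Longrightarrow> t j < t i"
    and "1 \<le> fact (Suc N) * (pow_max + 1) * 2 ^ N * real (q k) *
           (\<Prod>i<N. real (q (Suc (t i))) * D (t i) / real (q (t i)))"
proof -
  let ?M = "Suc N"
  have nodep: "\<forall>j<?M. a j = 0" if "\<And>s. s \<ge> k \<Longrightarrow> (\<Sum>j<?M. x s j * a j) = 0" for a
  proof -
    have "\<forall>\<^sub>F s in sequentially. (\<Sum>j\<le>N. of_int (x s j) * of_int (a j)) = (0 :: real)"
    proof (rule eventually_sequentiallyI)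
      fix s assume "k \<le> s"
      then have "real_of_int (\<Sum>j\<le>N. x s j * a j) = 0"
        using that[of s] by (simp add: lessThan_Suc_atMost)
      then show "(\<Sum>j\<le>N. of_int (x s j) * of_int (a j)) = (0 :: real)"
        by simp
    qed
    then show ?thesis
      using no_linear_relation[OF limit_functional[of a]] by (auto simp: eventually_frequently)
  qed
  from spanning_chain[where k = k and M = ?M and x = x and m = N, OF nodep lessI] obtain t where
    t: "\<And>i. i < N \<Longrightarrow> k \<le> t i" "\<And>i j. i < N \<Longrightarrow> j < i \<Longrightarrow> t j < t i"
    and new: "\<And>i. i < N \<Longrightarrow> \<not> lin_span ?M (chain_row x k t) i (x (Suc (t i)))"
    and old: "\<And>i. i < N \<Longrightarrow> lin_span ?M (chain_row x k t) i (x (t i))"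
    by (metis atLeastAtMost_iff lessI order_refl)
  let ?v = "chain_row x k t"
  have "det (mat ?M ?M (\<lambda>(i, j). ?v i j)) \<noteq> 0"
  proof (rule det_nonzero_if_independent)
    show "\<exists>j<?M. ?v 0 j \<noteq> 0"
      using q_pos[of k] by (intro exI[of _ 0]) simp
    show "\<not> lin_span ?M ?v i (?v (Suc i))" if "Suc i < ?M" for i
      using new that by simp
  qed
  then have "1 \<le> \<bar>det (mat ?M ?M (\<lambda>(i, j). ?v i j))\<bar>"
    by linarith
  moreover have "map_mat real_of_int (mat ?M ?M (\<lambda>(i, j). ?v i j)) = mat ?M ?M (\<lambda>(i, j). real_of_int (?v i j))"
    by (intro eq_matI) auto
  ultimately have det1: "1 \<le> \<bar>det (mat ?M ?M (\<lambda>(i, j). real_of_int (?v i j)))\<bar>"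
    by (metis of_int_hom.hom_det of_int_abs of_int_1_le_iff)
  \<comment> \<open>This multiple of \<open>x (t i)\<close> cancels the main term of
    \<open>x (Suc (t i))\<close> in every column at once, so that only approximation errors
    remain.\<close>
  define r where "r i = real (q (Suc (t i))) / real (q (t i))" for i
  have r: "1 \<le> r i" for i
    using q_less[of "t i"] q_pos[of "t i"] by (simp add: r_def field_simps)
  define w where "w i j = (case i of 0 \<Rightarrow> real_of_int (x k j)
      | Suc i' \<Rightarrow> of_int (x (Suc (t i')) j) - r i' * of_int (x (t i') j))" for i j
  \<comment> \<open>Since \<open>x (t i)\<close> lies in the span of rows 0 to i, subtracting a
    multiple of it from row \<open>Suc i\<close> is an operation with earlier rows and keeps the
    determinant.\<close>
  have "\<forall>i. \<exists>c. i < N \<longrightarrow> (\<forall>j<?M. real_of_int (x (t i) j) = (\<Sum>l\<le>i. c l * of_int (?v l j)))"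
    using old unfolding lin_span_def by blast
  then obtain c where c: "\<And>i j. i < N \<Longrightarrow> j < ?M \<Longrightarrow> real_of_int (x (t i) j) = (\<Sum>l\<le>i. c i l * of_int (?v l j))"
    by metis
  define e where "e i l = (case i of 0 \<Rightarrow> 0 | Suc i' \<Rightarrow> - r i' * c i' l)" for i l
  have "det (mat ?M ?M (\<lambda>(i, j). w i j)) = det (mat ?M ?M (\<lambda>(i, j). real_of_int (?v i j)))"
  proof (rule det_subtract_earlier_rows)
    fix i j assume "i < ?M" "j < ?M"
    then show "w i j = real_of_int (?v i j) + (\<Sum>l<i. e i l * real_of_int (?v l j))"
      by (cases i) (simp_all add: w_def e_def c lessThan_Suc_atMost sum_negf sum_distrib_left mult.assoc)
  qed
  moreover define b where "b i = (case i of 0 \<Rightarrow> (pow_max + 1) * real (q k)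
      | Suc i' \<Rightarrow> 2 * (r i' * D (t i')))" for i
  have wb: "\<bar>w i j\<bar> \<le> b i" if "i < ?M" "j < ?M" for i j
  proof (cases i)
    case 0
    have "\<bar>\<zeta> ^ j * real (q k)\<bar> \<le> pow_max * real (q k)"
      using abs_pow_le_pow_max[of j] that by (simp add: abs_mult mult_right_mono)
    moreover have "\<bar>\<zeta> ^ j * real (q k) - real_of_int (x k j)\<bar> \<le> 1 / 2"
      using of_int_round_abs_le[of "\<zeta> ^ j * real (q k)"] by (simp add: near_pow_def abs_minus_commute)
    ultimately have "\<bar>real_of_int (x k j)\<bar> \<le> pow_max * real (q k) + 1"
      by linarith
    also have "\<dots> \<le> b i"
      using q_pos[of k] 0 by (simp add: b_def algebra_simps)
    finally show ?thesis
      by (simp add: w_def 0)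
  next
    case (Suc i')
    have j: "j \<le> N"
      using that by simp
    define e1 e2 where "e1 = \<zeta> ^ j * real (q (Suc (t i'))) - of_int (x (Suc (t i')) j)"
      and "e2 = \<zeta> ^ j * real (q (t i')) - of_int (x (t i') j)"
    have "r i' * real (q (t i')) = real (q (Suc (t i')))"
      using q_pos[of "t i'"] by (simp add: r_def)
    then have eq: "\<zeta> ^ j * real (q (Suc (t i'))) = r i' * (\<zeta> ^ j * real (q (t i')))"
      by (metis mult.left_commute)
    have "w i j = r i' * e2 - e1"
      unfolding w_def e1_def e2_def eq Suc by (simp add: right_diff_distrib)
    also have "\<bar>\<dots>\<bar> \<le> r i' * \<bar>e2\<bar> + \<bar>e1\<bar>"
      using r[of i'] abs_triangle_ineq4[of "r i' * e2" e1] by (simp add: abs_mult)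
    also have "\<dots> \<le> r i' * D (t i') + 1 * D (t i')"
      using x_err[OF j, of "t i'"] x_err[OF j, of "Suc (t i')"] D_antimono[of "t i'" "Suc (t i')"] r[of i']
      unfolding e1_def e2_def by (intro add_mono mult_left_mono) auto
    also have "\<dots> \<le> r i' * D (t i') + r i' * D (t i')"
      using r[of i'] D_pos[of "t i'"] by (intro add_mono mult_right_mono) auto
    finally show ?thesis
      by (simp add: b_def Suc)
  qed
  ultimately have "1 \<le> fact ?M * (\<Prod>i<?M. b i)"
    using det1 abs_det_le[of ?M w b, OF wb] by linarith
  also have "(\<Prod>i<?M. b i) = (pow_max + 1) * real (q k) * (2 ^ N * (\<Prod>i<N. r i * D (t i)))"
    unfolding prod.lessThan_Suc_shift by (simp add: b_def prod.distrib)
  finally have "1 \<le> fact (Suc N) * (pow_max + 1) * 2 ^ N * real (q k) *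
           (\<Prod>i<N. real (q (Suc (t i))) * D (t i) / real (q (t i)))"
    by (simp add: r_def mult_ac)
  with t show thesis
    by (rule that)
qed

text \<open>If the inequality failed, the bound in \<open>determinant_estimate\<close> would tend to
  0. With \<open>Q = q (Suc (t 0))\<close>, the factor of \<open>t 0\<close> times
  \<open>q k\<close> is at most \<open>Q powr (1 - \<alpha>)\<close>, and each of the other N - 1
  factors is at most \<open>Q powr (\<theta> - 1)\<close>, because its index is at least
  \<open>Suc (t 0)\<close>.\<close>

lemma schmidt_summerer:
  assumes "2 \<le> N" and \<alpha>: "0 < \<alpha>" "\<alpha> < 1"
    and upper: "\<forall>\<^sub>F k in sequentially. D k \<le> real (q (Suc k)) powr (- \<alpha>)"
    and lower: "\<forall>\<^sub>F k in sequentially. real (q k) powr (- \<beta>) < D k"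
  shows "\<alpha> * (real N - 2 + \<alpha>) \<le> (real N - 1) * (1 - \<alpha>) * \<beta>"
proof (rule ccontr)
  assume neg: "\<not> ?thesis"
  \<comment> \<open>Eliminating \<open>D k\<close> between the two hypotheses gives
    \<open>growth\<close>, with exactly this exponent.\<close>
  define \<theta> where "\<theta> = \<beta> * (1 - \<alpha>) / \<alpha>"
  \<comment> \<open>This is the total exponent of Q in the estimate; the negated claim amounts to
    \<gamma> < 0.\<close>
  define \<gamma> where "\<gamma> = 1 - \<alpha> + (real N - 1) * (\<theta> - 1)"
  define C where "C = fact (Suc N) * (pow_max + 1) * (2::real) ^ N"
  have "0 < C"
    unfolding C_def using pow_max_pos by (intro mult_pos_pos add_pos_pos) auto
  have "\<alpha> * ((real N - 1) * \<theta>) < \<alpha> * (real N - 2 + \<alpha>)"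
    using neg \<alpha> by (simp add: \<theta>_def algebra_simps)
  then have "(real N - 1) * \<theta> < real N - 2 + \<alpha>"
    using \<alpha> by simp
  then have \<gamma>: "\<gamma> < 0"
    by (simp add: \<gamma>_def algebra_simps)
  \<comment> \<open>Now powers with exponent \<theta> - 1 decrease in the base, so the later factors
    can be compared with the value at Q.\<close>
  have \<theta>: "\<theta> < 1"
  proof (rule ccontr)
    assume "\<not> \<theta> < 1"
    then have "0 \<le> (real N - 1) * (\<theta> - 1)"
      using assms(1) by (intro mult_nonneg_nonneg) auto
    then show False
      using \<gamma> \<alpha> by (simp add: \<gamma>_def)
  qed
  have q1: "1 \<le> real (q k)" for k
    using q_pos[of k] by simp
  obtain K where K: "\<And>k. K \<le> k \<Longrightarrow> D k \<le> real (q (Suc k)) powr (- \<alpha>)"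
    "\<And>k. K \<le> k \<Longrightarrow> real (q k) powr (- \<beta>) < D k"
    using eventually_conj[OF upper lower] unfolding eventually_sequentially by blast
  have vol: "real (q (Suc k)) * D k \<le> real (q (Suc k)) powr (1 - \<alpha>)" if "K \<le> k" for k
  proof -
    have "real (q (Suc k)) * D k \<le> real (q (Suc k)) * real (q (Suc k)) powr (- \<alpha>)"
      using K(1)[OF that] by (intro mult_left_mono) auto
    also have "\<dots> = real (q (Suc k)) powr (1 - \<alpha>)"
      using q1[of "Suc k"] by (simp add: powr_diff powr_minus field_simps)
    finally show ?thesis .
  qed
  have growth: "real (q (Suc k)) powr (1 - \<alpha>) \<le> real (q k) powr \<theta>" if "K \<le> k" for k
  proof -
    have "real (q k) powr (- \<beta>) < real (q (Suc k)) powr (- \<alpha>)"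
      using K[OF that] by linarith
    then have "real (q (Suc k)) powr \<alpha> \<le> real (q k) powr \<beta>"
      using q1[of k] q1[of "Suc k"] by (simp add: powr_minus field_simps)
    then have "(real (q (Suc k)) powr \<alpha>) powr ((1 - \<alpha>) / \<alpha>) \<le> (real (q k) powr \<beta>) powr ((1 - \<alpha>) / \<alpha>)"
      using \<alpha> by (intro powr_mono2) auto
    then show ?thesis
      using \<alpha> by (simp add: powr_powr \<theta>_def)
  qed
  have "((\<lambda>k. C * real (q k) powr \<gamma>) \<longlongrightarrow> C * 0) sequentially"
    using tendsto_neg_powr[OF \<gamma> q_at_top] by (intro tendsto_mult_left)
  then have "\<forall>\<^sub>F k in sequentially. C * real (q k) powr \<gamma> < 1"
    by (rule order_tendstoD) simp
  then obtain k where k: "K \<le> k" "C * real (q k) powr \<gamma> < 1"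
    unfolding eventually_sequentially by (meson nle_le)
  obtain t where t: "\<And>i. i < N \<Longrightarrow> k \<le> t i" "\<And>i j. i < N \<Longrightarrow> j < i \<Longrightarrow> t j < t i"
    and det: "1 \<le> C * real (q k) * (\<Prod>i<N. real (q (Suc (t i))) * D (t i) / real (q (t i)))"
    using determinant_estimate[of k] unfolding C_def by blast
  obtain n where n: "N = Suc n"
    using assms(1) by (cases N) auto
  define Q where "Q = real (q (Suc (t 0)))"
  have t0: "k \<le> t 0"
    using t(1) n by simp
  have "real (q k) * (\<Prod>i<N. real (q (Suc (t i))) * D (t i) / real (q (t i)))
      = real (q k) * (Q * D (t 0) / real (q (t 0))) *
        (\<Prod>i<n. real (q (Suc (t (Suc i)))) * D (t (Suc i)) / real (q (t (Suc i))))"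
    unfolding n prod.lessThan_Suc_shift by (simp add: Q_def)
  also have "\<dots> \<le> Q powr (1 - \<alpha>) * (\<Prod>i<n. Q powr (\<theta> - 1))"
  proof (intro mult_mono prod_mono conjI)
    have "real (q k) * (Q * D (t 0) / real (q (t 0))) = real (q k) / real (q (t 0)) * (Q * D (t 0))"
      by simp
    also have "\<dots> \<le> 1 * (Q * D (t 0))"
      using q_mono[OF t0] q1[of "t 0"] D_pos[of "t 0"] by (intro mult_right_mono) (auto simp: Q_def)
    also have "\<dots> \<le> Q powr (1 - \<alpha>)"
      using vol[of "t 0"] t0 k(1) by (simp add: Q_def)
    finally show "real (q k) * (Q * D (t 0) / real (q (t 0))) \<le> Q powr (1 - \<alpha>)" .
  next
    fix i assume "i \<in> {..<n}"
    then have i: "k \<le> t (Suc i)" "Suc (t 0) \<le> t (Suc i)"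
      using t(1)[of "Suc i"] t(2)[of "Suc i" 0] n by auto
    let ?p = "real (q (t (Suc i)))"
    have "real (q (Suc (t (Suc i)))) * D (t (Suc i)) \<le> ?p powr \<theta>"
      using vol[of "t (Suc i)"] growth[of "t (Suc i)"] i k(1) by linarith
    then have "real (q (Suc (t (Suc i)))) * D (t (Suc i)) / ?p \<le> ?p powr \<theta> / ?p"
      by (intro divide_right_mono) auto
    also have "\<dots> = ?p powr (\<theta> - 1)"
      using q1[of "t (Suc i)"] by (simp add: powr_diff)
    also have "\<dots> \<le> Q powr (\<theta> - 1)"
      using q_mono[OF i(2)] q1[of "Suc (t 0)"] \<theta> unfolding Q_def by (intro powr_mono2') auto
    finally show "real (q (Suc (t (Suc i)))) * D (t (Suc i)) / ?p \<le> Q powr (\<theta> - 1)" .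
  qed (auto intro!: prod_nonneg mult_nonneg_nonneg divide_nonneg_nonneg less_imp_le[OF D_pos] simp: Q_def)
  also have "\<dots> = Q powr (1 - \<alpha>) * Q powr (real n * (\<theta> - 1))"
    using q1[of "Suc (t 0)"] by (simp add: powr_powr[symmetric] powr_realpow Q_def mult.commute[of "real n"])
  also have "\<dots> = Q powr \<gamma>"
    by (simp add: powr_add[symmetric] \<gamma>_def n)
  also have "\<dots> \<le> real (q k) powr \<gamma>"
    using q_mono[of k "Suc (t 0)"] t0 q1[of k] \<gamma> unfolding Q_def by (intro powr_mono2') auto
  finally have "C * (real (q k) * (\<Prod>i<N. real (q (Suc (t i))) * D (t i) / real (q (t i)))) \<le> C * real (q k) powr \<gamma>"
    using \<open>0 < C\<close> by (intro mult_left_mono) auto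
  then show False
    using det k(2) by (simp add: mult.assoc)
qed

end

subsection \<open>Polynomials annihilating an integer point\<close>

definition seq_functional :: "nat \<Rightarrow> (nat \<Rightarrow> int) \<Rightarrow> rat poly \<Rightarrow> rat" where
  "seq_functional N x R = (\<Sum>i\<le>N. coeff R i * of_int (x i))"

text \<open>This says that x obeys the linear recurrence with characteristic polynomial R on every
  window inside 0..N. Rational coefficients make gcds and Bezout identities available; a polynomial
  of degree above N annihilates vacuously.\<close>

definition annihilates :: "nat \<Rightarrow> rat poly \<Rightarrow> (nat \<Rightarrow> int) \<Rightarrow> bool" where
  "annihilates N R x \<longleftrightarrow> (\<forall>S. degree (R * S) \<le> N \<longrightarrow> seq_functional N x (R * S) = 0)"

lemma seq_functional_add: "seq_functional N x (R + S) = seq_functional N x R + seq_functional N x S"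
  by (simp add: seq_functional_def distrib_right sum.distrib)

lemma seq_functional_sum: "seq_functional N x (\<Sum>i\<in>I. f i) = (\<Sum>i\<in>I. seq_functional N x (f i))"
  unfolding seq_functional_def coeff_sum sum_distrib_right by (rule sum.swap)

text \<open>A multiple of P is a combination of shifts of P by monomials, and the functional of the
  shift by s is the window sum starting at s.\<close>

lemma annihilates_of_int_polyI:
  fixes P :: "int poly"
  assumes "\<And>i. i + degree P \<le> N \<Longrightarrow> (\<Sum>j\<le>degree P. coeff P j * x (i + j)) = 0"
  shows "annihilates N (of_int_poly P) x"
  unfolding annihilates_def
proof (intro allI impI)
  fix S :: "rat poly"
  let ?R = "of_int_poly P :: rat poly"
  assume deg: "degree (?R * S) \<le> N"
  show "seq_functional N x (?R * S) = 0"
  proof (cases "P = 0 \<or> S = 0")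
    case True
    then show ?thesis
      by (auto simp: seq_functional_def)
  next
    case False
    then have deg: "degree P + degree S \<le> N"
      using deg by (simp add: degree_mult_eq)
    have "?R * S = (\<Sum>s\<le>degree S. monom (coeff S s) s * ?R)"
      by (subst (1) poly_as_sum_of_monoms[of S, symmetric]) (simp add: sum_distrib_left mult.commute)
    moreover have "seq_functional N x (monom c s * ?R) = 0" if "s \<le> degree S" for c s
    proof -
      have s: "s + degree P \<le> N"
        using that deg by simp
      have "seq_functional N x (monom c s * ?R) = (\<Sum>i\<in>{s..s + degree P}. c * of_int (coeff P (i - s) * x i))"
        unfolding seq_functional_def coeff_monom_mult
        using s by (intro sum.mono_neutral_cong_right) (auto simp: coeff_eq_0)
      also have "\<dots> = (\<Sum>j\<in>{0..degree P}. c * of_int (coeff P j * x (s + j)))"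
        by (rule sum.reindex_bij_witness[of _ "\<lambda>j. s + j" "\<lambda>i. i - s"]) auto
      also have "\<dots> = c * of_int (\<Sum>j\<le>degree P. coeff P j * x (s + j))"
        by (simp add: sum_distrib_left atMost_atLeast0)
      finally show ?thesis
        using assms[OF s] by (simp only: of_int_0 mult_zero_right)
    qed
    ultimately show ?thesis
      by (simp add: seq_functional_sum)
  qed
qed

lemma annihilates_of_int_polyD:
  fixes P :: "int poly"
  assumes "annihilates N (of_int_poly P) x" "degree P \<le> N"
  shows "(\<Sum>j\<le>N. coeff P j * x j) = 0"
proof -
  have "seq_functional N x (of_int_poly P * 1) = 0"
    using assms(1)[unfolded annihilates_def, rule_format, of 1] assms(2) by simp
  then have "rat_of_int (\<Sum>j\<le>N. coeff P j * x j) = 0"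
    by (simp add: seq_functional_def)
  then show ?thesis
    by (simp only: of_int_eq_0_iff)
qed

text \<open>Bezout writes a multiple of the gcd as a sum of multiples of P and Q. These may cancel
  above degree N, where the hypotheses say nothing, so their degrees have to be controlled.\<close>

lemma annihilates_gcd:
  fixes P Q :: "rat poly"
  assumes "P \<noteq> 0" and P: "annihilates N P x" and Q: "annihilates N Q x"
    and deg: "degree P + degree Q \<le> Suc N"
  shows "annihilates N (gcd P Q) x"
  unfolding annihilates_def
proof (intro allI impI)
  fix S
  assume S: "degree (gcd P Q * S) \<le> N"
  obtain P' Q' where P': "P = gcd P Q * P'" and Q': "Q = gcd P Q * Q'"
    by (meson dvdE gcd_dvd1 gcd_dvd2)
  define U V where "U = fst (bezout_coefficients P Q)" and "V = snd (bezout_coefficients P Q)"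
  have UV: "U * P + V * Q = gcd P Q"
    by (simp add: U_def V_def bezout_coefficients_fst_snd)
  have "P' \<noteq> 0"
    using P' assms(1) by auto
  \<comment> \<open>Reducing the cofactor of Q modulo P' keeps every multiple of P and Q that occurs in degree at most N.\<close>
  define B where "B = (V * S) mod P'"
  define E where "E = (V * S) div P'"
  have VS: "V * S = E * P' + B"
    by (simp add: B_def E_def)
  have "gcd P Q * S = U * P * S + V * S * Q"
    using arg_cong[OF UV, of "\<lambda>p. p * S"] by (simp add: algebra_simps)
  also have "\<dots> = U * P * S + E * (P' * Q) + B * Q"
    unfolding VS by (simp add: algebra_simps)
  also have "P' * Q = P * Q'"
    using P' Q' by (metis mult.assoc mult.commute)
  finally have split: "gcd P Q * S = P * (U * S + E * Q') + Q * B"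
    by (simp add: algebra_simps)
  \<comment> \<open>The degree of B is strictly below that of P; this gain of one is why
    \<open>Suc N\<close> suffices in \<open>deg\<close>.\<close>
  have dB: "degree (Q * B) \<le> N"
  proof (cases "B = 0 \<or> Q = 0")
    case False
    then have "degree B < degree P'"
      using degree_mod_less[OF \<open>P' \<noteq> 0\<close>, of "V * S"] by (auto simp: B_def)
    moreover have "degree P' \<le> degree P"
      using P' assms(1) by (metis dvd_imp_degree_le dvd_triv_right)
    ultimately show ?thesis
      using False deg by (simp add: degree_mult_eq)
  qed auto
  have "P * (U * S + E * Q') = gcd P Q * S - Q * B"
    using split by simp
  then have "degree (P * (U * S + E * Q')) \<le> N"
    using S dB by (metis degree_diff_le)
  then show "seq_functional N x (gcd P Q * S) = 0"
    using P Q dB unfolding split seq_functional_add annihilates_def by simp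
qed

text \<open>Take a rational annihilator of least degree. By \<open>annihilates_gcd\<close> its gcd
  with Q also annihilates, so minimality makes it divide Q. Passing to the normalized integer
  polynomial turns this into divisibility over the integers, by Gauss's lemma.\<close>

lemma minimal_annihilator_exists:
  fixes R :: "int poly"
  assumes "R \<noteq> 0" "annihilates N (of_int_poly R) x" "degree R \<le> n"
  obtains p :: "int poly" where "p \<noteq> 0" "degree p \<le> n" "annihilates N (of_int_poly p) x"
    and "\<And>Q :: int poly. annihilates N (of_int_poly Q) x \<Longrightarrow> degree Q + n \<le> Suc N \<Longrightarrow> p dvd Q"
proof -
  let ?ok = "\<lambda>R :: rat poly. R \<noteq> 0 \<and> annihilates N R x"
  have "?ok (of_int_poly R)"
    using assms by simp
  then obtain P where P: "P \<noteq> 0" "annihilates N P x" and min: "\<And>R. ?ok R \<Longrightarrow> degree P \<le> degree R"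
    using ex_has_least_nat[of ?ok _ degree] by blast
  have degP: "degree P \<le> n"
    using min[of "of_int_poly R"] assms by simp
  obtain r p where rp: "rat_to_normalized_int_poly P = (r, p)"
    by fastforce
  note p = rat_to_normalized_int_poly[OF rp]
  have "r \<noteq> 0" "p \<noteq> 0"
    using p P(1) by auto
  have "annihilates N (of_int_poly p) x"
    unfolding annihilates_def
  proof (intro allI impI)
    fix S :: "rat poly" assume "degree (of_int_poly p * S) \<le> N"
    moreover have eq: "of_int_poly p * S = P * smult (1 / r) S"
      using \<open>r \<noteq> 0\<close> by (subst p(1)) simp
    ultimately show "seq_functional N x (of_int_poly p * S) = 0"
      using P(2) unfolding annihilates_def by (metis (no_types))
  qed
  moreover have "p dvd Q" if Q: "annihilates N (of_int_poly Q) x" "degree Q + n \<le> Suc N" for Q :: "int poly"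
  proof -
    let ?G = "gcd P (of_int_poly Q)"
    have "annihilates N ?G x"
      using P Q degP by (intro annihilates_gcd) auto
    then have "degree P \<le> degree ?G"
      using P(1) by (intro min) auto
    obtain P' where P': "P = ?G * P'"
      by (meson dvdE gcd_dvd1)
    have "?G \<noteq> 0" "P' \<noteq> 0"
      using P(1) P' by auto
    then have "degree P = degree ?G + degree P'"
      using P' degree_mult_eq by metis
    then have "is_unit P'"
      using \<open>degree P \<le> degree ?G\<close> \<open>P' \<noteq> 0\<close> by (simp add: is_unit_iff_degree)
    then have "P dvd ?G"
      using P' by (metis dvd_refl mult_unit_dvd_iff)
    then have "P dvd of_int_poly Q"
      using dvd_trans by blast
    then obtain h where "of_int_poly Q = P * h"
      by (elim dvdE)
    from rat_to_int_factor_explicit[OF this rp] show ?thesis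
      by (metis dvd_triv_left)
  qed
  ultimately show thesis
    using \<open>p \<noteq> 0\<close> p(4) degP that by simp
qed

text \<open>The Mahler measure carries the bound: Landau's inequality bounds that of Q by the
  Euclidean norm, a factor has no larger measure, and Mignotte's bound returns to
  coefficients.\<close>

lemma coeff_dvd_le:
  fixes P Q :: "int poly"
  assumes "P dvd Q" "Q \<noteq> 0" "degree Q \<le> d" "\<And>j. \<bar>real_of_int (coeff Q j)\<bar> \<le> H"
  shows "\<bar>real_of_int (coeff P j)\<bar> \<le> 2 ^ d * ((real d + 1) * H)"
proof -
  have H: "0 \<le> H"
    using assms(4)[of 0] by linarith
  have "mahler_measure Q \<le> sqrt (\<Sum>a\<leftarrow>coeffs (map_poly complex_of_int Q). (cmod a)\<^sup>2)"
    unfolding mahler_measure_def by (rule Landau_inequality)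
  also have "(\<Sum>a\<leftarrow>coeffs (map_poly complex_of_int Q). (cmod a)\<^sup>2) = (\<Sum>j\<le>degree Q. (real_of_int (coeff Q j))\<^sup>2)"
    using assms(2)
    by (simp add: coeffs_def interv_sum_list_conv_sum_set_nat atLeast0AtMost atLeastLessThanSuc_atLeastAtMost
        del: upt_Suc)
  also have "\<dots> \<le> (\<Sum>j\<le>degree Q. H\<^sup>2)"
    using assms(4) H by (intro sum_mono) (simp add: abs_le_square_iff[symmetric])
  also have "\<dots> \<le> ((real d + 1) * H)\<^sup>2"
  proof -
    have "real (Suc (degree Q)) * H\<^sup>2 \<le> (real d + 1)\<^sup>2 * H\<^sup>2"
      using assms(3) self_le_power[of "real d + 1" 2] by (intro mult_right_mono) auto
    then show ?thesis
      by (simp add: power_mult_distrib)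
  qed
  finally have M: "mahler_measure Q \<le> (real d + 1) * H"
    using H by simp
  have "degree P \<le> d"
    using assms(1-3) dvd_imp_degree_le le_trans by blast
  have "\<bar>real_of_int (coeff P j)\<bar> \<le> real (degree P choose j) * mahler_measure P"
    using Mignotte_bound[of P j] by simp
  also have "\<dots> \<le> 2 ^ d * mahler_measure Q"
  proof (intro mult_mono mahler_measure_dvd assms)
    have "degree P choose j \<le> 2 ^ degree P"
      by (rule binomial_le_pow2)
    also have "\<dots> \<le> 2 ^ d"
      using \<open>degree P \<le> d\<close> by (intro power_increasing) auto
    finally have "real (degree P choose j) \<le> real (2 ^ d)"
      by (simp only: of_nat_le_iff)
    then show "real (degree P choose j) \<le> 2 ^ d"
      by simp
  qed (auto simp: mahler_measure_ge_0)
  also have "\<dots> \<le> 2 ^ d * ((real d + 1) * H)"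
    using M by (intro mult_left_mono) auto
  finally show ?thesis .
qed

subsection \<open>Dirichlet's theorem for polynomial values\<close>

text \<open>Pigeonhole principle: \<open>Suc h ^ d\<close> coefficient vectors without constant term
  compete for \<open>h ^ d\<close> intervals of fractional parts, and Q is the difference of two
  vectors in the same interval.\<close>

lemma small_polynomial_value:
  fixes \<zeta> :: real
  assumes d: "1 \<le> d" and h: "1 \<le> h"
  shows "\<exists>Q :: int poly. Q \<noteq> 0 \<and> degree Q \<le> d \<and>
    (\<forall>j. \<bar>real_of_int (coeff Q j)\<bar> \<le> (1 + (\<Sum>i=1..d. \<bar>\<zeta>\<bar> ^ i)) * real h) \<and>
    \<bar>poly (of_int_poly Q) \<zeta>\<bar> \<le> 1 / real h ^ d"
proof -
  let ?S = "{1..d} \<rightarrow>\<^sub>E {0..h}"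
  define val where "val a = (\<Sum>i=1..d. real (a i) * \<zeta> ^ i)" for a :: "nat \<Rightarrow> nat"
  define box where "box a = nat \<lfloor>real (h ^ d) * frac (val a)\<rfloor>" for a
  have hd: "0 < real (h ^ d)"
    using h by simp
  have "box ` ?S \<subseteq> {..<h ^ d}"
  proof (rule image_subsetI)
    fix a
    have "real (h ^ d) * frac (val a) < real (h ^ d) * 1"
      using hd frac_lt_1 by (intro mult_strict_left_mono)
    then have "\<lfloor>real (h ^ d) * frac (val a)\<rfloor> < int (h ^ d)"
      by (simp add: floor_less_iff)
    then show "box a \<in> {..<h ^ d}"
      using h unfolding box_def by (simp add: nat_less_iff)
  qed
  then have "card (box ` ?S) \<le> h ^ d"
    using card_mono[of "{..<h ^ d}"] by fastforce
  also have "h ^ d < Suc h ^ d"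
    using d by (intro power_strict_mono) auto
  also have "\<dots> = card ?S"
    by (simp add: card_PiE)
  finally have "\<not> inj_on box ?S"
    by (rule pigeonhole)
  then obtain a b where ab: "a \<in> ?S" "b \<in> ?S" "a \<noteq> b" "box a = box b"
    unfolding inj_on_def by blast
  have "\<exists>i\<in>{1..d}. a i \<noteq> b i"
  proof (rule ccontr)
    assume "\<not> ?thesis"
    then have "a = b"
      using ab by (intro PiE_ext[of a "{1..d}" _ b]) auto
    with ab show False by simp
  qed
  then obtain i0 where i0: "i0 \<in> {1..d}" "a i0 \<noteq> b i0"
    by blast
  \<comment> \<open>Used as the constant term, the difference of the integer parts turns the value
    at \<zeta> into a difference of fractional parts.\<close>
  define m where "m = \<lfloor>val a\<rfloor> - \<lfloor>val b\<rfloor>"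
  define f where "f i = (if i = 0 then - m else int (a i) - int (b i))" for i
  define Q where "Q = (\<Sum>i\<le>d. monom (f i) i)"
  have coeff: "coeff Q j = (if j \<le> d then f j else 0)" for j
    unfolding Q_def by (simp add: coeff_sum if_distrib cong: if_cong)
  have "Q \<noteq> 0"
    using coeff[of i0] i0 by (auto simp: f_def)
  have "degree Q \<le> d"
    by (rule degree_le) (simp add: coeff)
  have "poly (of_int_poly Q) \<zeta> = (\<Sum>i\<le>d. of_int (f i) * \<zeta> ^ i)"
    by (simp add: Q_def hom_distribs poly_sum poly_monom)
  also have "\<dots> = of_int (f 0) + (\<Sum>i=1..d. of_int (f i) * \<zeta> ^ i)"
    by (simp add: atMost_atLeast0 sum.atLeast_Suc_atMost)
  also have "(\<Sum>i=1..d. of_int (f i) * \<zeta> ^ i) = val a - val b"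
    unfolding val_def sum_subtractf[symmetric] by (intro sum.cong) (auto simp: f_def algebra_simps)
  finally have Q\<zeta>: "poly (of_int_poly Q) \<zeta> = frac (val a) - frac (val b)"
    by (simp add: f_def m_def frac_def)
  have "\<bar>real (h ^ d) * frac (val a) - real (h ^ d) * frac (val b)\<bar> \<le> 1"
  proof -
    have "\<lfloor>real (h ^ d) * frac (val a)\<rfloor> = \<lfloor>real (h ^ d) * frac (val b)\<rfloor>"
      using ab(4) hd unfolding box_def by (subst (asm) eq_nat_nat_iff) auto
    then show ?thesis
      by linarith
  qed
  then have "real (h ^ d) * \<bar>poly (of_int_poly Q) \<zeta>\<bar> \<le> 1"
    unfolding Q\<zeta> using hd by (simp add: abs_mult right_diff_distrib[symmetric])
  then have small: "\<bar>poly (of_int_poly Q) \<zeta>\<bar> \<le> 1 / real h ^ d"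
    using hd by (simp add: field_simps)
  let ?C = "1 + (\<Sum>i=1..d. \<bar>\<zeta>\<bar> ^ i)"
  have C1: "1 \<le> ?C"
    by (simp add: sum_nonneg)
  have diff: "\<bar>real (a i) - real (b i)\<bar> \<le> real h" if "i \<in> {1..d}" for i
  proof -
    have "a i \<le> h" "b i \<le> h"
      using that ab(1,2) by (auto simp: PiE_iff)
    then show ?thesis
      by linarith
  qed
  have "\<bar>val a - val b\<bar> \<le> (\<Sum>i=1..d. \<bar>real (a i) - real (b i)\<bar> * \<bar>\<zeta>\<bar> ^ i)"
    unfolding val_def sum_subtractf[symmetric]
    by (rule order_trans[OF sum_abs]) (simp add: left_diff_distrib[symmetric] abs_mult power_abs)
  also have "\<dots> \<le> (\<Sum>i=1..d. real h * \<bar>\<zeta>\<bar> ^ i)"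
    using diff by (intro sum_mono mult_right_mono) auto
  finally have "\<bar>val a - val b\<bar> \<le> real h * (\<Sum>i=1..d. \<bar>\<zeta>\<bar> ^ i)"
    by (simp add: sum_distrib_left)
  moreover have "\<bar>real_of_int m\<bar> \<le> \<bar>val a - val b\<bar> + 1"
    unfolding m_def by linarith
  ultimately have m: "\<bar>real_of_int m\<bar> \<le> ?C * real h"
    using h by (simp add: algebra_simps)
  have "\<bar>real_of_int (coeff Q j)\<bar> \<le> ?C * real h" for j
  proof -
    consider "j = 0" | "j \<in> {1..d}" | "d < j"
      by fastforce
    then show ?thesis
    proof cases
      case 1
      then show ?thesis
        using m by (simp add: coeff f_def)
    next
      case 2
      then have "\<bar>real_of_int (coeff Q j)\<bar> = \<bar>real (a j) - real (b j)\<bar>"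
        by (auto simp: coeff f_def)
      also have "\<dots> \<le> 1 * real h"
        using diff[OF 2] by simp
      also have "\<dots> \<le> ?C * real h"
        using C1 by (intro mult_right_mono) auto
      finally show ?thesis .
    next
      case 3
      then show ?thesis
        using C1 by (simp add: coeff)
    qed
  qed
  then show ?thesis
    using \<open>Q \<noteq> 0\<close> \<open>degree Q \<le> d\<close> small by blast
qed

lemma dirichlet_polynomial:
  fixes \<zeta> :: real
  assumes d: "1 \<le> d" and c: "0 < c"
  obtains C where "0 < C"
    and "\<And>Y. 1 \<le> Y \<Longrightarrow> \<exists>Q :: int poly. Q \<noteq> 0 \<and> degree Q \<le> d \<and>
      (\<forall>j. \<bar>real_of_int (coeff Q j)\<bar> \<le> C * Y powr (1 / real d)) \<and> \<bar>poly (of_int_poly Q) \<zeta>\<bar> \<le> c / Y"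
proof -
  define A where "A = 1 + (\<Sum>i=1..d. \<bar>\<zeta>\<bar> ^ i)"
  \<comment> \<open>The power of 1 / c ensures \<open>h ^ d \<ge> Y / c\<close> below; the summand 1
    ensures h \<ge> 1.\<close>
  define B where "B = 1 + (1 / c) powr (1 / real d)"
  have A: "0 < A"
    unfolding A_def by (intro add_pos_nonneg sum_nonneg) auto
  have B: "1 \<le> B"
    by (simp add: B_def)
  show thesis
  proof (rule that)
    show "0 < A * (B + 1)"
      using A B by simp
    fix Y :: real assume Y: "1 \<le> Y"
    define y where "y = Y powr (1 / real d)"
    define h where "h = nat \<lceil>B * y\<rceil>"
    have y: "1 \<le> y"
      using Y by (simp add: y_def ge_one_powr_ge_zero)
    have "1 \<le> B * y"
      using B y by (metis mult_mono' mult.right_neutral zero_le_one)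
    then have h: "B * y \<le> real h" "real h \<le> B * y + 1" "1 \<le> h"
      unfolding h_def by linarith+
    from small_polynomial_value[OF d h(3), of \<zeta>] obtain Q :: "int poly" where Q: "Q \<noteq> 0" "degree Q \<le> d"
      "\<And>j. \<bar>real_of_int (coeff Q j)\<bar> \<le> A * real h" "\<bar>poly (of_int_poly Q) \<zeta>\<bar> \<le> 1 / real h ^ d"
      unfolding A_def by blast
    have "Y / c = ((1 / c) powr (1 / real d) * y) ^ d"
      using c Y d by (simp add: y_def power_mult_distrib powr_powr powr_realpow[symmetric])
    also have "\<dots> \<le> real h ^ d"
    proof (intro power_mono)
      have "(1 / c) powr (1 / real d) * y \<le> B * y"
        using y by (intro mult_right_mono) (auto simp: B_def)
      then show "(1 / c) powr (1 / real d) * y \<le> real h"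
        using h by linarith
    qed (use y in auto)
    finally have "1 / real h ^ d \<le> 1 / (Y / c)"
      using c Y h(3) by (intro divide_left_mono) auto
    then have "\<bar>poly (of_int_poly Q) \<zeta>\<bar> \<le> c / Y"
      using Q(4) by simp
    moreover have "\<bar>real_of_int (coeff Q j)\<bar> \<le> A * (B + 1) * Y powr (1 / real d)" for j
    proof -
      have "real h \<le> (B + 1) * y"
        using h(2) y by (simp add: algebra_simps)
      then have "A * real h \<le> A * ((B + 1) * y)"
        using A by (intro mult_left_mono) auto
      then show ?thesis
        using Q(3)[of j] by (simp add: y_def mult.assoc)
    qed
    ultimately show "\<exists>Q :: int poly. Q \<noteq> 0 \<and> degree Q \<le> d \<and>
      (\<forall>j. \<bar>real_of_int (coeff Q j)\<bar> \<le> A * (B + 1) * Y powr (1 / real d)) \<and> \<bar>poly (of_int_poly Q) \<zeta>\<bar> \<le> c / Y"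
      using Q by blast
  qed
qed

section \<open>Descent of minimal annihilators along the best approximations\<close>

context best_approx
begin

text \<open>An integer window sum is split into a main term, governed by the value of P at \<zeta>,
  and the contribution of the approximation errors.\<close>

lemma window_identity:
  fixes P :: "int poly"
  shows "real_of_int (\<Sum>j\<le>degree P. coeff P j * x k (i + j))
    = real (q k) * \<zeta> ^ i * poly (of_int_poly P) \<zeta>
      - (\<Sum>j\<le>degree P. of_int (coeff P j) * (\<zeta> ^ (i + j) * real (q k) - of_int (x k (i + j))))"
proof -
  have "real (q k) * \<zeta> ^ i * poly (of_int_poly P) \<zeta>
      = (\<Sum>j\<le>degree P. of_int (coeff P j) * (\<zeta> ^ (i + j) * real (q k)))"
    by (simp add: poly_altdef sum_distrib_left power_add mult_ac)
  then show ?thesis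
    by (simp add: right_diff_distrib sum_subtractf)
qed

lemma window_error_le:
  fixes P :: "int poly"
  assumes "\<And>j. \<bar>real_of_int (coeff P j)\<bar> \<le> H" "i + degree P \<le> N"
  shows "\<bar>\<Sum>j\<le>degree P. of_int (coeff P j) * (\<zeta> ^ (i + j) * real (q k) - of_int (x k (i + j)))\<bar>
    \<le> (real N + 1) * (H * D k)"
proof -
  have H: "0 \<le> H"
    using assms(1)[of 0] by linarith
  have "\<bar>\<Sum>j\<le>degree P. of_int (coeff P j) * (\<zeta> ^ (i + j) * real (q k) - of_int (x k (i + j)))\<bar>
    \<le> (\<Sum>j\<le>degree P. H * D k)"
  proof (intro order_trans[OF sum_abs] sum_mono)
    fix j assume "j \<in> {..degree P}"
    then have "\<bar>\<zeta> ^ (i + j) * real (q k) - of_int (x k (i + j))\<bar> \<le> D k"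
      using assms(2) by (intro x_err) auto
    then show "\<bar>of_int (coeff P j) * (\<zeta> ^ (i + j) * real (q k) - of_int (x k (i + j)))\<bar> \<le> H * D k"
      unfolding abs_mult using assms(1) H by (intro mult_mono) auto
  qed
  also have "\<dots> \<le> (real N + 1) * (H * D k)"
    using assms(2) H D_pos[of k] by (simp add: mult_right_mono)
  finally show ?thesis .
qed

text \<open>Every window sum is an integer of absolute value below 1, hence zero.\<close>

lemma annihilates_if_small:
  fixes P :: "int poly"
  assumes H: "\<And>j. \<bar>real_of_int (coeff P j)\<bar> \<le> H"
    and small: "pow_max * (real (q k) * \<bar>poly (of_int_poly P) \<zeta>\<bar>) + (real N + 1) * (H * D k) < 1"
  shows "annihilates N (of_int_poly P) (x k)"
proof (rule annihilates_of_int_polyI)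
  fix i assume i: "i + degree P \<le> N"
  let ?s = "\<Sum>j\<le>degree P. coeff P j * x k (i + j)"
  have "\<bar>real_of_int ?s\<bar> \<le> \<bar>real (q k) * \<zeta> ^ i * poly (of_int_poly P) \<zeta>\<bar> + (real N + 1) * (H * D k)"
    unfolding window_identity
    by (rule order_trans[OF abs_triangle_ineq4 add_left_mono[OF window_error_le[OF H i]]])
  also have "\<bar>real (q k) * \<zeta> ^ i * poly (of_int_poly P) \<zeta>\<bar> = \<bar>\<zeta> ^ i\<bar> * (real (q k) * \<bar>poly (of_int_poly P) \<zeta>\<bar>)"
    by (simp add: abs_mult)
  also have "\<dots> \<le> pow_max * (real (q k) * \<bar>poly (of_int_poly P) \<zeta>\<bar>)"
    using i by (intro mult_right_mono abs_pow_le_pow_max) auto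
  finally have "\<bar>real_of_int ?s\<bar> < 1"
    using small by linarith
  then show "?s = 0"
    by linarith
qed

text \<open>Conversely, when the window sum at 0 vanishes, the main term equals the error
  term.\<close>

lemma value_le_if_annihilates:
  fixes P :: "int poly"
  assumes H: "\<And>j. \<bar>real_of_int (coeff P j)\<bar> \<le> H" and deg: "degree P \<le> N"
    and ann: "annihilates N (of_int_poly P) (x k)"
  shows "real (q k) * \<bar>poly (of_int_poly P) \<zeta>\<bar> \<le> (real N + 1) * (H * D k)"
proof -
  have "(\<Sum>j\<le>degree P. coeff P j * x k j) = (\<Sum>j\<le>N. coeff P j * x k j)"
    using deg by (intro sum.mono_neutral_left) (auto simp: coeff_eq_0)
  then have "real_of_int (\<Sum>j\<le>degree P. coeff P j * x k (0 + j)) = 0"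
    using annihilates_of_int_polyD[OF ann deg] by simp
  then have "real (q k) * poly (of_int_poly P) \<zeta>
      = (\<Sum>j\<le>degree P. of_int (coeff P j) * (\<zeta> ^ (0 + j) * real (q k) - of_int (x k (0 + j))))"
    unfolding window_identity by simp
  then have "\<bar>real (q k) * poly (of_int_poly P) \<zeta>\<bar> \<le> (real N + 1) * (H * D k)"
    using window_error_le[OF H, of 0 k] deg by simp
  then show ?thesis
    by (simp add: abs_mult)
qed

lemma not_annihilates_eventually:
  fixes P :: "int poly"
  assumes "P \<noteq> 0" "degree P \<le> N"
  shows "\<not> (\<exists>\<^sub>F k in sequentially. annihilates N (of_int_poly P) (x k))"
proof
  assume "\<exists>\<^sub>F k in sequentially. annihilates N (of_int_poly P) (x k)"
  then have "\<exists>\<^sub>F k in sequentially. (\<Sum>j\<le>N. of_int (x k j) * of_int (coeff P j)) = (0 :: real)"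
  proof (rule frequently_elim1)
    fix k assume "annihilates N (of_int_poly P) (x k)"
    then have "real_of_int (\<Sum>j\<le>N. coeff P j * x k j) = 0"
      using annihilates_of_int_polyD[OF _ assms(2)] by (simp only: of_int_0)
    then show "(\<Sum>j\<le>N. of_int (x k j) * of_int (coeff P j)) = (0 :: real)"
      by (simp add: mult.commute)
  qed
  then have "coeff P (degree P) = 0"
    using no_linear_relation[OF limit_functional] assms(2) by blast
  with assms(1) show False
    by simp
qed

text \<open>Dirichlet's theorem in degree n with Y = X keeps the main term of each window sum at
  most 1/4, thanks to the constant \<open>1 / (4 * pow_max)\<close>. The error term is of order
  \<open>X powr (1 / n - \<beta>)\<close>, which tends to 0.\<close>

lemma frequently_low_degree_annihilator:
  assumes "1 \<le> n" "1 / real n < \<beta>"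
    and freq: "\<exists>\<^sub>F k in sequentially. \<exists>X. real (q k) \<le> X \<and> D k \<le> X powr (- \<beta>)"
  shows "\<exists>\<^sub>F k in sequentially. \<exists>P :: int poly. P \<noteq> 0 \<and> degree P \<le> n \<and> annihilates N (of_int_poly P) (x k)"
proof -
  obtain C where C: "0 < C" "\<And>Y. 1 \<le> Y \<Longrightarrow> \<exists>Q :: int poly. Q \<noteq> 0 \<and> degree Q \<le> n \<and>
      (\<forall>j. \<bar>real_of_int (coeff Q j)\<bar> \<le> C * Y powr (1 / real n)) \<and> \<bar>poly (of_int_poly Q) \<zeta>\<bar> \<le> (1 / (4 * pow_max)) / Y"
    using dirichlet_polynomial[OF assms(1), of "1 / (4 * pow_max)" \<zeta>] pow_max_pos by auto
  let ?\<gamma> = "1 / real n - \<beta>"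
  have \<gamma>: "?\<gamma> < 0"
    using assms by simp
  have "((\<lambda>k. (real N + 1) * C * real (q k) powr ?\<gamma>) \<longlongrightarrow> (real N + 1) * C * 0) sequentially"
    using tendsto_neg_powr[OF \<gamma> q_at_top] by (intro tendsto_mult_left)
  then have "\<forall>\<^sub>F k in sequentially. (real N + 1) * C * real (q k) powr ?\<gamma> < 1 / 2"
    by (rule order_tendstoD) simp
  from frequently_eventually_frequently[OF freq this] show ?thesis
  proof (rule frequently_elim1)
    fix k assume "(\<exists>X. real (q k) \<le> X \<and> D k \<le> X powr (- \<beta>)) \<and> (real N + 1) * C * real (q k) powr ?\<gamma> < 1 / 2"
    then obtain X where X: "real (q k) \<le> X" "D k \<le> X powr (- \<beta>)"
      and small: "(real N + 1) * C * real (q k) powr ?\<gamma> < 1 / 2"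
      by blast
    have q1: "1 \<le> real (q k)"
      using q_pos[of k] by simp
    then have "1 \<le> X"
      using X by linarith
    from C(2)[OF this] obtain Q :: "int poly" where Q: "Q \<noteq> 0" "degree Q \<le> n"
      "\<And>j. \<bar>real_of_int (coeff Q j)\<bar> \<le> C * X powr (1 / real n)"
      "\<bar>poly (of_int_poly Q) \<zeta>\<bar> \<le> (1 / (4 * pow_max)) / X"
      by blast
    have "annihilates N (of_int_poly Q) (x k)"
    proof (rule annihilates_if_small[OF Q(3)])
      have "pow_max * (real (q k) * \<bar>poly (of_int_poly Q) \<zeta>\<bar>) \<le> pow_max * (X * ((1 / (4 * pow_max)) / X))"
        using pow_max_pos X Q(4) \<open>1 \<le> X\<close> by (intro mult_left_mono mult_mono) auto
      also have "\<dots> = 1 / 4"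
        using pow_max_pos \<open>1 \<le> X\<close> by simp
      finally have 1: "pow_max * (real (q k) * \<bar>poly (of_int_poly Q) \<zeta>\<bar>) \<le> 1 / 4" .
      have "(real N + 1) * (C * X powr (1 / real n) * D k) \<le> (real N + 1) * (C * X powr (1 / real n) * X powr (- \<beta>))"
        using X C(1) by (intro mult_left_mono) auto
      also have "\<dots> = (real N + 1) * C * X powr ?\<gamma>"
        by (simp add: powr_add[symmetric] mult.assoc)
      also have "\<dots> \<le> (real N + 1) * C * real (q k) powr ?\<gamma>"
        using X q1 \<gamma> C(1) by (intro mult_left_mono powr_mono2') auto
      finally show "pow_max * (real (q k) * \<bar>poly (of_int_poly Q) \<zeta>\<bar>) + (real N + 1) * (C * X powr (1 / real n) * D k) < 1"
        using 1 small by linarith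
    qed
    then show "\<exists>P :: int poly. P \<noteq> 0 \<and> degree P \<le> n \<and> annihilates N (of_int_poly P) (x k)"
      using Q by blast
  qed
qed

text \<open>For N = 2n the degree condition on Q reads \<open>degree Q \<le> Suc n\<close>. This
  admits the Dirichlet polynomials of degree n + 1 as well as the minimal annihilators of
  neighbouring points.\<close>

definition min_ann :: "nat \<Rightarrow> nat \<Rightarrow> int poly \<Rightarrow> bool" where
  "min_ann n k p \<longleftrightarrow> p \<noteq> 0 \<and> degree p \<le> n \<and> annihilates N (of_int_poly p) (x k) \<and>
     (\<forall>Q :: int poly. annihilates N (of_int_poly Q) (x k) \<longrightarrow> degree Q + n \<le> Suc N \<longrightarrow> p dvd Q)"

lemma min_ann_exists:
  fixes P :: "int poly"
  assumes "P \<noteq> 0" "degree P \<le> n" "annihilates N (of_int_poly P) (x k)"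
  shows "\<exists>p. min_ann n k p"
  using minimal_annihilator_exists[OF assms(1,3,2)] unfolding min_ann_def by metis

text \<open>With H the height bound for p inherited from a Dirichlet polynomial,
  \<open>H * D k\<close> is small by \<open>upper\<close>. The value of p at \<zeta> is controlled
  through its annihilation of \<open>x (Suc k)\<close>, so both terms of the window sums of
  \<open>x k\<close> are small.\<close>

lemma eventually_min_ann_descends:
  assumes N2: "N = 2 * n" and \<alpha>: "1 / (real n + 1) < \<alpha>"
    and upper: "\<forall>\<^sub>F k in sequentially. D k \<le> real (q (Suc k)) powr (- \<alpha>)"
  shows "\<forall>\<^sub>F k in sequentially. \<forall>p. min_ann n (Suc k) p \<longrightarrow> annihilates N (of_int_poly p) (x k)"
proof -
  let ?d = "Suc n"
  obtain C where C: "0 < C" "\<And>Y. 1 \<le> Y \<Longrightarrow> \<exists>Q :: int poly. Q \<noteq> 0 \<and> degree Q \<le> ?d \<and>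
      (\<forall>j. \<bar>real_of_int (coeff Q j)\<bar> \<le> C * Y powr (1 / real ?d)) \<and> \<bar>poly (of_int_poly Q) \<zeta>\<bar> \<le> (1 / (4 * pow_max)) / Y"
    using dirichlet_polynomial[of ?d "1 / (4 * pow_max)" \<zeta>] pow_max_pos by auto
  \<comment> \<open>The loss in passing from Q to a divisor, as in
    \<open>coeff_dvd_le\<close>.\<close>
  define C' where "C' = 2 ^ ?d * ((real ?d + 1) * C)"
  have "1 * C \<le> (2 ^ ?d * (real ?d + 1)) * C"
  proof (intro mult_right_mono)
    have "1 * 1 \<le> 2 ^ ?d * (real ?d + 1)"
      by (intro mult_mono one_le_power) auto
    then show "1 \<le> 2 ^ ?d * (real ?d + 1)"
      by simp
  qed (use C in auto)
  then have C': "C \<le> C'" "0 < C'"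
    using C(1) by (auto simp: C'_def mult.assoc)
  let ?\<gamma> = "1 / real ?d - \<alpha>"
  have \<gamma>: "?\<gamma> < 0"
    using \<alpha> by (simp add: add.commute)
  define K where "K = (pow_max + 1) * (real N + 1) * C'"
  have "((\<lambda>k. K * real (q (Suc k)) powr ?\<gamma>) \<longlongrightarrow> K * 0) sequentially"
    by (intro tendsto_mult_left tendsto_neg_powr[OF \<gamma>] filterlim_compose[OF q_at_top] filterlim_Suc)
  then have "\<forall>\<^sub>F k in sequentially. K * real (q (Suc k)) powr ?\<gamma> < 1 / 2"
    by (rule order_tendstoD) simp
  with upper show ?thesis
  proof eventually_elim
    case (elim k)
    define y where "y = real (q (Suc k)) powr (1 / real ?d)"
    have "1 \<le> real (q (Suc k))"
      using q_pos[of "Suc k"] by simp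
    from C(2)[OF this] obtain Q :: "int poly" where Q: "Q \<noteq> 0" "degree Q \<le> ?d"
      "\<And>j. \<bar>real_of_int (coeff Q j)\<bar> \<le> C * y"
      "\<bar>poly (of_int_poly Q) \<zeta>\<bar> \<le> (1 / (4 * pow_max)) / real (q (Suc k))"
      unfolding y_def by blast
    have y0: "0 \<le> y"
      by (simp add: y_def)
    define e where "e = (real N + 1) * (C' * y * D k)"
    have e0: "0 \<le> e"
      using y0 C' D_pos[of k] by (auto simp: e_def intro!: mult_nonneg_nonneg)
    have "e \<le> (real N + 1) * (C' * y * real (q (Suc k)) powr (- \<alpha>))"
      unfolding e_def using elim(1) C' y0 by (intro mult_left_mono) auto
    also have "\<dots> = (real N + 1) * C' * real (q (Suc k)) powr ?\<gamma>"
      by (simp add: y_def powr_add[symmetric] mult.assoc)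
    finally have "(pow_max + 1) * e \<le> K * real (q (Suc k)) powr ?\<gamma>"
      using pow_max_pos by (simp add: K_def mult.assoc)
    then have "(pow_max + 1) * e < 1 / 2"
      using elim(2) by linarith
    moreover have "0 \<le> pow_max * e"
      using pow_max_pos e0 by simp
    ultimately have e1: "pow_max * e + e < 1 / 2" "e < 1 / 2"
      by (auto simp: distrib_right)
    have DS: "D (Suc k) \<le> D k"
      by (intro D_antimono) simp
    have annQ: "annihilates N (of_int_poly Q) (x (Suc k))"
    proof (rule annihilates_if_small[OF Q(3)])
      have "pow_max * (real (q (Suc k)) * \<bar>poly (of_int_poly Q) \<zeta>\<bar>) \<le> pow_max * (real (q (Suc k)) * ((1 / (4 * pow_max)) / real (q (Suc k))))"
        using pow_max_pos Q(4) by (intro mult_left_mono) auto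
      also have "\<dots> = 1 / 4"
        using pow_max_pos q_pos[of "Suc k"] by simp
      finally have 1: "pow_max * (real (q (Suc k)) * \<bar>poly (of_int_poly Q) \<zeta>\<bar>) \<le> 1 / 4" .
      have "(real N + 1) * (C * y * D (Suc k)) \<le> e"
        unfolding e_def using C' C(1) y0 DS D_pos[of "Suc k"] by (intro mult_left_mono mult_mono) auto
      then show "pow_max * (real (q (Suc k)) * \<bar>poly (of_int_poly Q) \<zeta>\<bar>) + (real N + 1) * (C * y * D (Suc k)) < 1"
        using 1 e1 by linarith
    qed
    show ?case
    proof (intro allI impI)
      fix p assume p: "min_ann n (Suc k) p"
      have "p dvd Q"
        using p annQ Q(2) N2 unfolding min_ann_def by auto
      have "2 ^ ?d * ((real ?d + 1) * (C * y)) = C' * y"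
        by (simp add: C'_def)
      then have coeffs: "\<bar>real_of_int (coeff p j)\<bar> \<le> C' * y" for j
        using coeff_dvd_le[OF \<open>p dvd Q\<close> Q(1,2,3), of j] by (simp only:)
      have deg: "degree p \<le> N" and ann: "annihilates N (of_int_poly p) (x (Suc k))"
        using p N2 unfolding min_ann_def by auto
      have "real (q k) * \<bar>poly (of_int_poly p) \<zeta>\<bar> \<le> real (q (Suc k)) * \<bar>poly (of_int_poly p) \<zeta>\<bar>"
        using q_less[of k] by (intro mult_right_mono) auto
      also have "\<dots> \<le> (real N + 1) * (C' * y * D (Suc k))"
        by (rule value_le_if_annihilates[OF coeffs deg ann])
      also have "\<dots> \<le> e"
        unfolding e_def using C' y0 DS by (intro mult_left_mono) auto
      finally have "pow_max * (real (q k) * \<bar>poly (of_int_poly p) \<zeta>\<bar>) \<le> pow_max * e"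
        using pow_max_pos by (intro mult_left_mono) auto
      then show "annihilates N (of_int_poly p) (x k)"
        using e1 by (intro annihilates_if_small[OF coeffs]) (simp add: e_def)
    qed
  qed
qed

lemma no_simultaneous_exponents:
  assumes N2: "N = 2 * n" and n: "1 \<le> n" and \<alpha>: "1 / (real n + 1) < \<alpha>" and \<beta>: "1 / real n < \<beta>"
    and upper: "\<forall>\<^sub>F k in sequentially. D k \<le> real (q (Suc k)) powr (- \<alpha>)"
    and freq: "\<exists>\<^sub>F k in sequentially. \<exists>X. real (q k) \<le> X \<and> D k \<le> X powr (- \<beta>)"
  shows False
proof -
  obtain K where K: "\<And>k p. K \<le> k \<Longrightarrow> min_ann n (Suc k) p \<Longrightarrow> annihilates N (of_int_poly p) (x k)"
    using eventually_min_ann_descends[OF N2 \<alpha> upper] unfolding eventually_sequentially by blast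
  \<comment> \<open>Annihilated points occur beyond every k; from such an m the annihilators descend
    one index at a time to k.\<close>
  have "\<exists>p. min_ann n k p" if "K \<le> k" for k
  proof -
    obtain m and P :: "int poly" where m: "k \<le> m" "P \<noteq> 0" "degree P \<le> n" "annihilates N (of_int_poly P) (x m)"
      using frequently_low_degree_annihilator[OF n \<beta> freq] unfolding frequently_sequentially by blast
    have "\<exists>p. min_ann n m p"
      using m by (intro min_ann_exists)
    with m(1) show ?thesis
    proof (induction rule: inc_induct)
      case (step j)
      then obtain p where p: "min_ann n (Suc j) p"
        by blast
      then have "annihilates N (of_int_poly p) (x j)"
        using K[of j p] step(1) that by simp
      with p show ?case
        unfolding min_ann_def[of n "Suc j"] by (intro min_ann_exists) auto
    qed
  qed
  then obtain p where p: "\<And>k. K \<le> k \<Longrightarrow> min_ann n k (p k)"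
    by metis
  \<comment> \<open>By the choice of K, \<open>p (Suc k)\<close> also annihilates
    \<open>x k\<close>, and its degree is within the range of the minimality of
    \<open>p k\<close>.\<close>
  have dvd_Suc: "p k dvd p (Suc k)" if "K \<le> k" for k
    using p[OF that] p[of "Suc k"] K[OF that, of "p (Suc k)"] that N2 unfolding min_ann_def by auto
  have dvd: "p k dvd p j" if "K \<le> k" "k \<le> j" for k j
    using that(2)
  proof (induction rule: dec_induct)
    case (step i)
    then show ?case
      using dvd_trans[OF step.IH dvd_Suc[of i]] that(1) by simp
  qed simp
  \<comment> \<open>Degrees are at most n, so a maximum is attained. From that index on,
    divisibility leaves only constant quotients, which are invertible over the rationals.\<close>
  obtain k where k: "K \<le> k" and max: "\<And>j. K \<le> j \<Longrightarrow> degree (p j) \<le> degree (p k)"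
    using ex_has_greatest_nat[of "\<lambda>k. K \<le> k" K "\<lambda>k. degree (p k)" "Suc n"] p
    unfolding min_ann_def by (metis le_imp_less_Suc order_refl)
  have "annihilates N (of_int_poly (p k)) (x j)" if kj: "k \<le> j" for j
  proof -
    have "K \<le> j"
      using k kj by simp
    obtain c where c: "p j = p k * c"
      using dvd[OF k kj] by (elim dvdE)
    have pj: "p j \<noteq> 0" "annihilates N (of_int_poly (p j)) (x j)" and "degree (p j) \<le> degree (p k)"
      using p[OF \<open>K \<le> j\<close>] max[OF \<open>K \<le> j\<close>] unfolding min_ann_def by auto
    then have "degree c = 0" "c \<noteq> 0"
      using c by (auto simp: degree_mult_eq)
    then obtain a where a: "c = [:a:]" "a \<noteq> 0"
      by (metis degree_eq_zeroE pCons_0_0)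
    show ?thesis
      unfolding annihilates_def
    proof (intro allI impI)
      fix S :: "rat poly" assume "degree (of_int_poly (p k) * S) \<le> N"
      moreover have "of_int_poly (p k) * S = of_int_poly (p j) * smult (1 / of_int a) S"
        using a c by (simp add: hom_distribs)
      ultimately show "seq_functional N (x j) (of_int_poly (p k) * S) = 0"
        using pj(2) unfolding annihilates_def by (metis (no_types))
    qed
  qed
  then have "\<forall>\<^sub>F j in sequentially. annihilates N (of_int_poly (p k)) (x j)"
    by (rule eventually_sequentiallyI)
  then have "\<exists>\<^sub>F j in sequentially. annihilates N (of_int_poly (p k)) (x j)"
    by (simp add: eventually_frequently)
  moreover have "p k \<noteq> 0" "degree (p k) \<le> N"
    using p[OF k] N2 unfolding min_ann_def by auto
  ultimately show False
    using not_annihilates_eventually by blast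
qed

end

subsection \<open>Exponents\<close>

lemma best_approx_if_solvable:
  assumes N: "1 \<le> N" and tr: "\<not> algebraic \<zeta>" and "0 < l"
    and ev: "\<forall>\<^sub>F X in at_top. approx_solvable N \<zeta> l X"
  shows "\<exists>q. best_approx N \<zeta> q"
proof (rule best_approx_exists[OF N tr])
  fix e :: real assume "0 < e"
  have "((\<lambda>X. X powr (- l)) \<longlongrightarrow> 0) at_top"
    using \<open>0 < l\<close> by (intro tendsto_neg_powr filterlim_ident) auto
  then have "\<forall>\<^sub>F X in at_top. X powr (- l) < e"
    using \<open>0 < e\<close> by (rule order_tendstoD)
  with ev have "\<forall>\<^sub>F X in at_top. approx_solvable N \<zeta> l X \<and> X powr (- l) < e"
    by (rule eventually_conj)
  then obtain X where "approx_solvable N \<zeta> l X" "X powr (- l) < e"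
    using eventually_happens by force
  then show "\<exists>m\<ge>1. pow_err N \<zeta> m < e"
    using approx_solvable_iff[OF N] by (meson le_less_trans)
qed

lemma ordinary_uniform_incompatible:
  assumes n: "1 \<le> n" and tr: "\<not> algebraic \<zeta>"
    and \<alpha>: "1 / (real n + 1) < \<alpha>" and \<beta>: "1 / real n < \<beta>"
    and ev: "\<forall>\<^sub>F X in at_top. approx_solvable (2 * n) \<zeta> \<alpha> X"
    and fr: "\<exists>\<^sub>F X in at_top. approx_solvable (2 * n) \<zeta> \<beta> X"
  shows False
proof -
  have "0 < 1 / (real n + 1)"
    by simp
  then have "0 < \<alpha>"
    using \<alpha> by linarith
  then obtain q where "best_approx (2 * n) \<zeta> q"
    using best_approx_if_solvable[OF _ tr _ ev] n by auto
  then interpret best_approx "2 * n" \<zeta> q .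
  show False
    using no_simultaneous_exponents[OF refl n \<alpha> \<beta> eventually_D_le[OF ev] frequently_D_le[OF fr]] .
qed

text \<open>For N = 2n, \<open>schmidt_summerer\<close> bounds the ordinary exponent below by b / c,
  and \<open>large\<close> is the inequality b / c > 1 / n with denominators cleared.\<close>

lemma ordinary_exponent_large:
  assumes n: "1 \<le> n" and tr: "\<not> algebraic \<zeta>" and \<alpha>: "0 < \<alpha>" "\<alpha> < 1"
    and large: "2 * real n - 1 < real n * \<alpha>\<^sup>2 + (2 * (real n)\<^sup>2 - 1) * \<alpha>"
    and ev: "\<forall>\<^sub>F X in at_top. approx_solvable (2 * n) \<zeta> \<alpha> X"
  shows "\<exists>\<beta>>1 / real n. \<exists>\<^sub>F X in at_top. approx_solvable (2 * n) \<zeta> \<beta> X"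
proof -
  define c where "c = (2 * real n - 1) * (1 - \<alpha>)"
  define b where "b = \<alpha> * (2 * real n - 2 + \<alpha>)"
  have c: "0 < c"
    using n \<alpha> by (simp add: c_def)
  have "c < real n * b"
    using large by (simp add: b_def c_def power2_eq_square algebra_simps)
  then have "1 / real n < b / c"
    using n c by (simp add: field_simps)
  then obtain \<beta> where \<beta>: "1 / real n < \<beta>" "\<beta> < b / c"
    using dense by blast
  then have "c * \<beta> < b"
    using c by (simp add: field_simps)
  have "\<exists>\<^sub>F X in at_top. approx_solvable (2 * n) \<zeta> \<beta> X"
  proof (rule ccontr)
    assume "\<not> ?thesis"
    then have never: "\<forall>\<^sub>F X in at_top. \<not> approx_solvable (2 * n) \<zeta> \<beta> X"
      by (simp add: frequently_def)
    obtain q where "best_approx (2 * n) \<zeta> q"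
      using best_approx_if_solvable[OF _ tr \<alpha>(1) ev] n by auto
    then interpret best_approx "2 * n" \<zeta> q .
    have "b \<le> c * \<beta>"
      using schmidt_summerer[OF _ \<alpha> eventually_D_le[OF ev] eventually_less_D[OF never]] n
      by (simp add: b_def c_def)
    with \<open>c * \<beta> < b\<close> show False
      by simp
  qed
  with \<beta>(1) show ?thesis
    by blast
qed

theorem theorem4p2:
  fixes n :: nat and \<zeta> :: real
  assumes "n \<ge> 1"
    and "\<not> algebraic \<zeta>"
  shows "lambda_hat_exp (2 * n) \<zeta>
           \<le> ereal (sqrt ((real n + 1 / (2 * real n))\<^sup>2 - 1 / real n) - real n + 1 / (2 * real n))
       \<and> (lambda_exp (2 * n) \<zeta> > ereal (1 / real n) \<longrightarrow>
            lambda_hat_exp (2 * n) \<zeta> \<le> ereal (1 / (real n + 1)))"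
proof -
  define r where "r = 1 / (2 * real n)"
  define s where "s = (real n + r)\<^sup>2 - 2 * r"
  \<comment> \<open>The first bound of the theorem, which is the larger root in t of the quadratic
    on the right of \<open>quad\<close>.\<close>
  define B where "B = sqrt s - real n + r"
  have n: "1 \<le> real n"
    using assms(1) by simp
  have nr: "real n * r = 1 / 2"
    using n by (simp add: r_def)
  have r: "0 < r" "r \<le> 1 / 2"
    using n by (auto simp: r_def field_simps)
  have quad: "real n * ((t + real n - r)\<^sup>2 - s) = real n * t\<^sup>2 + (2 * (real n)\<^sup>2 - 1) * t - (2 * real n - 1)" for t
  proof -
    have "real n * ((t + real n - r)\<^sup>2 - s) = real n * t\<^sup>2 + 2 * (real n)\<^sup>2 * t - 2 * (real n * r) * t
        - 4 * (real n * r) * real n + 2 * (real n * r)"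
      unfolding s_def by (simp add: power2_eq_square algebra_simps)
    then show ?thesis
      unfolding nr by (simp add: algebra_simps)
  qed
  \<comment> \<open>The quadratic takes the value \<open>- (1 - t)\<^sup>2\<close> at t = 1 / (n +
    1), so this t does not exceed the larger root. Exponents above B thus satisfy the hypothesis of
    \<open>ordinary_uniform_incompatible\<close>.\<close>
  have B_ge: "1 / (real n + 1) \<le> B"
  proof -
    define t where "t = 1 / (real n + 1)"
    have nt: "real n * t = 1 - t"
      by (simp add: t_def field_simps)
    have "real n * t\<^sup>2 + (2 * (real n)\<^sup>2 - 1) * t - (2 * real n - 1)
        = (real n * t) * t + 2 * real n * (real n * t) - t - 2 * real n + 1"
      by (simp add: power2_eq_square algebra_simps)
    also have "\<dots> = (1 - t) * t - 2 * (real n * t) - t + 1"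
      by (subst (1 2) nt) (simp add: algebra_simps)
    also have "\<dots> = - (1 - t)\<^sup>2"
      unfolding nt by (simp add: power2_eq_square algebra_simps)
    finally have "real n * t\<^sup>2 + (2 * (real n)\<^sup>2 - 1) * t - (2 * real n - 1) \<le> 0"
      by simp
    then have "real n * ((t + real n - r)\<^sup>2 - s) \<le> 0"
      unfolding quad by simp
    then have "(t + real n - r)\<^sup>2 \<le> s"
      using n by (simp add: mult_le_0_iff)
    then have "t + real n - r \<le> sqrt s"
      by (rule real_le_rsqrt)
    then show ?thesis
      by (simp add: B_def t_def)
  qed
  \<comment> \<open>This leaves room for an exponent between B and 1, as
    \<open>ordinary_exponent_large\<close> requires \<alpha> < 1.\<close>
  have B_less: "B < 1"
  proof -
    have "real n * ((1 + real n - r)\<^sup>2 - s) = real n * (2 * real n - 1)"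
      unfolding quad by (simp add: power2_eq_square algebra_simps)
    also have "\<dots> > 0"
      using n by (intro mult_pos_pos) auto
    finally have "s < (1 + real n - r)\<^sup>2"
      using n by (simp add: zero_less_mult_iff)
    then have "sqrt s < sqrt ((1 + real n - r)\<^sup>2)"
      by (rule real_sqrt_less_mono)
    then show ?thesis
      using n r by (simp add: B_def)
  qed
  have "lambda_hat_exp (2 * n) \<zeta> \<le> ereal B"
  proof (rule ccontr)
    assume "\<not> ?thesis"
    then obtain a where a: "B < a" "\<forall>\<^sub>F X in at_top. approx_solvable (2 * n) \<zeta> a X"
      unfolding lambda_hat_exp_def not_le less_Sup_iff by auto
    obtain \<alpha> where \<alpha>: "B < \<alpha>" "\<alpha> < min a 1"
      using dense[of B "min a 1"] a B_less by auto
    have ev: "\<forall>\<^sub>F X in at_top. approx_solvable (2 * n) \<zeta> \<alpha> X"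
      using a(2) eventually_ge_at_top[of 1]
      by eventually_elim (use approx_solvable_mono \<alpha> in auto)
    have "1 / (real n + 1) < \<alpha>"
      using \<alpha> B_ge by linarith
    moreover have "0 < 1 / (real n + 1)"
      by simp
    ultimately have "0 < \<alpha>"
      by linarith
    have "\<not> (\<alpha> + real n - r)\<^sup>2 \<le> s"
      using real_le_rsqrt[of "\<alpha> + real n - r" s] \<alpha> by (auto simp: B_def)
    then have "0 < real n * ((\<alpha> + real n - r)\<^sup>2 - s)"
      using n by (intro mult_pos_pos) auto
    then have "2 * real n - 1 < real n * \<alpha>\<^sup>2 + (2 * (real n)\<^sup>2 - 1) * \<alpha>"
      unfolding quad by simp
    \<comment> \<open>A uniform exponent above B forces an ordinary exponent above 1 / n, which is
      incompatible with a uniform exponent above 1 / (n + 1).\<close>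
    then obtain \<beta> where "1 / real n < \<beta>" "\<exists>\<^sub>F X in at_top. approx_solvable (2 * n) \<zeta> \<beta> X"
      using ordinary_exponent_large[OF assms \<open>0 < \<alpha>\<close> _ _ ev] \<alpha> by auto
    then show False
      using ordinary_uniform_incompatible[OF assms \<open>1 / (real n + 1) < \<alpha>\<close> _ ev] by blast
  qed
  moreover have "lambda_hat_exp (2 * n) \<zeta> \<le> ereal (1 / (real n + 1))"
    if ord: "lambda_exp (2 * n) \<zeta> > ereal (1 / real n)"
  proof (rule ccontr)
    assume "\<not> ?thesis"
    then obtain \<alpha> where "1 / (real n + 1) < \<alpha>" "\<forall>\<^sub>F X in at_top. approx_solvable (2 * n) \<zeta> \<alpha> X"
      unfolding lambda_hat_exp_def not_le less_Sup_iff by auto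
    moreover obtain \<beta> where "1 / real n < \<beta>" "\<exists>\<^sub>F X in at_top. approx_solvable (2 * n) \<zeta> \<beta> X"
      using ord unfolding lambda_exp_def less_Sup_iff by auto
    ultimately show False
      using ordinary_uniform_incompatible[OF assms] by blast
  qed
  ultimately show ?thesis
    by (simp add: B_def s_def r_def)
qed

end
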